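(* Let $0<\alpha\le\gamma\le 1$ with $\alpha+\gamma>1$, let $0<\sigma<1$, and let $w$ be the solution on $(0,T]$ of the Volterra integral equation $$H(t)\,w(t)-\int_0^t E(t,\tau)\,w(\tau)\,d\tau=G(t),\qquad 0<t\le T,$$ with $H,E,G$ as in the context. Suppose $w$ is twice continuously differentiable on $(0,T]$ and that there are constants $a,b,C_0$ such that, for $0<t\le T$, $$|w(t)|\le a(1+t^{\alpha})+b\,t^{\gamma-1}\qquad\text{and}\qquad |w'(t)|+t\,|w''(t)|\le C_0\,t^{\sigma-1}.$$ Let $1\le\delta\le 2/\sigma$, let $t_n=(n/N)^{\delta}T$ for $0\le n\le N$ be the graded mesh, $I_n=(t_{n-1},t_n]$, $\Delta t_n=t_n-t_{n-1}$, $\Delta t=\max_{1\le n\le N}\Delta t_n$, and let $\tilde w$ be the discontinuous piecewise linear collocation solution on this mesh (defined in the context). Then there are constants $C>0$ and $k_0>0$, independent of $N$ and $n$, such that whenever $\Delta t<k_0$, $$\|w-\tilde w\|_{L^\infty(I_n)}\le C(\Delta t)^{\sigma\delta}\qquad\text{for all }1\le n\le N.$$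
   Context: Fix $T>0$. The data are functions $h(x,t)$, $g(x)$ on $0\le x\le1$ and $q(t)$ on $[0,T]$. Put $\lambda_i=2\pi i$ for $i\ge1$, $h_{1i}(t)=\int_0^1 h(x,t)\sin(\lambda_i x)\,dx$, $g_{1i}=\int_0^1 g(x)\sin(\lambda_i x)\,dx$, and $H(t)=\int_0^1h(x,t)\,dx$. The two-parameter Mittag-Leffler function is $E_{\alpha,\beta}(z)=\sum_{k\ge0}z^k/\Gamma(\alpha k+\beta)$, and $\Theta_i^{\mu}(t)=t^{\mu-1}E_{\alpha,\mu}(-\lambda_i^2t^\alpha)$ for $\mu\in\{\alpha,\gamma\}$. For $0<\mu<1$, $I^\mu y(t)=\int_0^t\frac{(t-\tau)^{\mu-1}}{\Gamma(\mu)}y(\tau)\,d\tau$ is the Riemann-Liouville fractional integral ($I^0$ is the identity), $D^\mu y=\frac{d}{dt}I^{1-\mu}y$ (and $D^1=\frac{d}{dt}$), and $D^{\alpha,\gamma}y(t)=D^\alpha\big(y(t)-\frac{(I^{1-\gamma}y)(0)}{\Gamma(\gamma)}t^{\gamma-1}\big)$. The kernel and right-hand side are $$E(t,\tau)=4\sum_{i=1}^\infty\lambda_i h_{1i}(\tau)\,\Theta_i^\alpha(t-\tau)=(t-\tau)^{\alpha-1}\tilde E(t,\tau),\qquad \tilde E(t,\tau)=4\sum_{i=1}^\infty\lambda_i h_{1i}(\tau)E_{\alpha,\alpha}(-\lambda_i^2(t-\tau)^\alpha),$$ $$G(t)=D^{\alpha,\gamma}q(t)+4\sum_{i=1}^\infty\lambda_i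 g_{1i}\Theta_i^\gamma(t).$$ Standing assumptions: the data are regular enough that the series converge, $\tilde E$ is continuous and bounded on $0\le\tau\le t\le T$ (for instance, $|h_{1i}(\tau)|\le C\lambda_i^{-2-\epsilon}$ for some $\epsilon>0$), and $G$ is continuous on $(0,T]$; $H$ is continuous on $[0,T]$ with $H(t)\neq0$ for all $t\in[0,T]$. Collocation scheme: fix $0<\xi_1<\xi_2<1$ (independent of $N$) and set $t_{n,j}=t_{n-1}+\xi_j\Delta t_n$ for $j=1,2$, $1\le n\le N$. Let $S$ be the space of functions on $(0,T]$ whose restriction to each $I_n$ is a polynomial of degree at most $1$ (no continuity is required at the nodes $t_n$). The collocation solution $\tilde w\in S$ is defined by $$H(t_{n,j})\tilde w(t_{n,j})-\int_0^{t_{n,j}}E(t_{n,j},\tau)\tilde w(\tau)\,d\tau=G(t_{n,j}),\qquad j=1,2,\ 1\le n\le N;$$ for $\Delta t$ sufficiently small it exists and is unique. The integrals are taken exactly. *)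

theory Defs
  imports
    "HOL-Analysis.Analysis"
    "HOL-Computational_Algebra.Polynomial"
    "HOL-Probability.Essential_Supremum"
begin

section \<open>Mittag-Leffler functions and fractional calculus\<close>

definition mittag_leffler :: "real \<Rightarrow> real \<Rightarrow> real \<Rightarrow> real" where
  "mittag_leffler \<alpha> \<beta> z = (\<Sum>k. z ^ k / Gamma (\<alpha> * real k + \<beta>))"

definition freq :: "nat \<Rightarrow> real" where
  "freq i = 2 * pi * real i"

definition Theta :: "real \<Rightarrow> real \<Rightarrow> nat \<Rightarrow> real \<Rightarrow> real" where
  "Theta \<alpha> \<mu> i t = t powr (\<mu> - 1) * mittag_leffler \<alpha> \<mu> (- (freq i)\<^sup>2 * t powr \<alpha>)"

definition frac_integral :: "real \<Rightarrow> (real \<Rightarrow> real) \<Rightarrow> real \<Rightarrow> real" where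
  "frac_integral \<mu> y t =
     (if \<mu> = 0 then y t
      else integral {0..t} (\<lambda>\<tau>. (t - \<tau>) powr (\<mu> - 1) / Gamma \<mu> * y \<tau>))"

definition frac_integral_exists :: "real \<Rightarrow> (real \<Rightarrow> real) \<Rightarrow> real \<Rightarrow> bool" where
  "frac_integral_exists \<mu> y t \<longleftrightarrow>
     \<mu> = 0 \<or> (\<lambda>\<tau>. (t - \<tau>) powr (\<mu> - 1) / Gamma \<mu> * y \<tau>) absolutely_integrable_on {0..t}"

text \<open>Functions of time live on the interval \<open>(0,T]\<close>, so the derivative at the right endpoint is
  one-sided.\<close>

definition frac_deriv :: "real \<Rightarrow> real \<Rightarrow> (real \<Rightarrow> real) \<Rightarrow> real \<Rightarrow> real" where
  "frac_deriv T \<mu> y t = vector_derivative (frac_integral (1 - \<mu>) y) (at t within {0<..T})"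

text \<open>The value \<open>(I\<^sup>1\<^sup>-\<^sup>\<gamma> y)(0)\<close> is the limit at \<open>0+\<close>: for \<open>\<gamma> < 1\<close> and \<open>y\<close> behaving like
  \<open>t\<^sup>\<gamma>\<^sup>-\<^sup>1\<close>, the integral over \<open>{0..0}\<close> would be \<open>0\<close> whereas the limit need not be.\<close>

definition frac_initial :: "real \<Rightarrow> (real \<Rightarrow> real) \<Rightarrow> real" where
  "frac_initial \<gamma> y = Lim (at_right 0) (frac_integral (1 - \<gamma>) y)"

definition subtract_initial :: "real \<Rightarrow> (real \<Rightarrow> real) \<Rightarrow> real \<Rightarrow> real" where
  "subtract_initial \<gamma> y t = y t - frac_initial \<gamma> y / Gamma \<gamma> * t powr (\<gamma> - 1)"

definition frac_deriv2 :: "real \<Rightarrow> real \<Rightarrow> real \<Rightarrow> (real \<Rightarrow> real) \<Rightarrow> real \<Rightarrow> real" where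
  "frac_deriv2 T \<alpha> \<gamma> y = frac_deriv T \<alpha> (subtract_initial \<gamma> y)"


section \<open>The Volterra equation\<close>

definition h_coeff :: "(real \<Rightarrow> real \<Rightarrow> real) \<Rightarrow> nat \<Rightarrow> real \<Rightarrow> real" where
  "h_coeff h i t = integral {0..1} (\<lambda>x. h x t * sin (freq i * x))"

definition g_coeff :: "(real \<Rightarrow> real) \<Rightarrow> nat \<Rightarrow> real" where
  "g_coeff g i = integral {0..1} (\<lambda>x. g x * sin (freq i * x))"

definition H_fun :: "(real \<Rightarrow> real \<Rightarrow> real) \<Rightarrow> real \<Rightarrow> real" where
  "H_fun h t = integral {0..1} (\<lambda>x. h x t)"

text \<open>The series below start at the index 1, hence the shift by \<open>Suc\<close>.\<close>

definition E_kernel :: "real \<Rightarrow> (real \<Rightarrow> real \<Rightarrow> real) \<Rightarrow> real \<Rightarrow> real \<Rightarrow> real" where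
  "E_kernel \<alpha> h t \<tau> =
     4 * (\<Sum>i. freq (Suc i) * h_coeff h (Suc i) \<tau> * Theta \<alpha> \<alpha> (Suc i) (t - \<tau>))"

definition E_tilde_term ::
    "real \<Rightarrow> (real \<Rightarrow> real \<Rightarrow> real) \<Rightarrow> real \<Rightarrow> real \<Rightarrow> nat \<Rightarrow> real" where
  "E_tilde_term \<alpha> h t \<tau> i =
     freq i * h_coeff h i \<tau> * mittag_leffler \<alpha> \<alpha> (- (freq i)\<^sup>2 * (t - \<tau>) powr \<alpha>)"

definition E_tilde :: "real \<Rightarrow> (real \<Rightarrow> real \<Rightarrow> real) \<Rightarrow> real \<Rightarrow> real \<Rightarrow> real" where
  "E_tilde \<alpha> h t \<tau> = 4 * (\<Sum>i. E_tilde_term \<alpha> h t \<tau> (Suc i))"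

lemma E_kernel_eq_E_tilde:
  assumes "summable (\<lambda>i. E_tilde_term \<alpha> h t \<tau> (Suc i))"
  shows "E_kernel \<alpha> h t \<tau> = (t - \<tau>) powr (\<alpha> - 1) * E_tilde \<alpha> h t \<tau>"
proof -
  have "(\<Sum>i. freq (Suc i) * h_coeff h (Suc i) \<tau> * Theta \<alpha> \<alpha> (Suc i) (t - \<tau>))
      = (\<Sum>i. (t - \<tau>) powr (\<alpha> - 1) * E_tilde_term \<alpha> h t \<tau> (Suc i))"
    by (simp add: Theta_def E_tilde_term_def mult_ac)
  also have "\<dots> = (t - \<tau>) powr (\<alpha> - 1) * (\<Sum>i. E_tilde_term \<alpha> h t \<tau> (Suc i))"
    using assms by (rule suminf_mult)
  finally show ?thesis
    by (simp add: E_kernel_def E_tilde_def)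
qed

definition G_fun ::
    "real \<Rightarrow> real \<Rightarrow> real \<Rightarrow> (real \<Rightarrow> real) \<Rightarrow> (real \<Rightarrow> real) \<Rightarrow> real \<Rightarrow> real" where
  "G_fun T \<alpha> \<gamma> g q t =
     frac_deriv2 T \<alpha> \<gamma> q t + 4 * (\<Sum>i. freq (Suc i) * g_coeff g (Suc i) * Theta \<alpha> \<gamma> (Suc i) t)"

text \<open>All integrals, limits, derivatives and series entering the kernel and the right-hand side
  exist, i.e. none of the total functions above takes an unspecified value.\<close>

definition regular_data ::
    "real \<Rightarrow> real \<Rightarrow> real \<Rightarrow> (real \<Rightarrow> real \<Rightarrow> real) \<Rightarrow> (real \<Rightarrow> real) \<Rightarrow> (real \<Rightarrow> real) \<Rightarrow> bool" where
  "regular_data T \<alpha> \<gamma> h g q \<longleftrightarrow>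
     (\<forall>t\<in>{0..T}. (\<lambda>x. h x t) absolutely_integrable_on {0..1}) \<and>
     g absolutely_integrable_on {0..1} \<and>
     (\<forall>t\<in>{0<..T}. frac_integral_exists (1 - \<gamma>) q t) \<and>
     (\<exists>l. (frac_integral (1 - \<gamma>) q \<longlongrightarrow> l) (at_right 0)) \<and>
     (\<forall>t\<in>{0<..T}. frac_integral_exists (1 - \<alpha>) (subtract_initial \<gamma> q) t) \<and>
     (\<forall>t\<in>{0<..T}. frac_integral (1 - \<alpha>) (subtract_initial \<gamma> q)
                     differentiable (at t within {0<..T})) \<and>
     (\<forall>t \<tau>. 0 \<le> \<tau> \<and> \<tau> \<le> t \<and> t \<le> T \<longrightarrow> summable (\<lambda>i. E_tilde_term \<alpha> h t \<tau> (Suc i))) \<and>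
     (\<forall>t\<in>{0<..T}. summable (\<lambda>i. freq (Suc i) * g_coeff g (Suc i) * Theta \<alpha> \<gamma> (Suc i) t))"

definition volterra_eq_at ::
    "real \<Rightarrow> real \<Rightarrow> real \<Rightarrow> (real \<Rightarrow> real \<Rightarrow> real) \<Rightarrow> (real \<Rightarrow> real) \<Rightarrow> (real \<Rightarrow> real)
      \<Rightarrow> (real \<Rightarrow> real) \<Rightarrow> real \<Rightarrow> bool" where
  "volterra_eq_at T \<alpha> \<gamma> h g q v t \<longleftrightarrow>
     H_fun h t * v t - integral {0..t} (\<lambda>\<tau>. E_kernel \<alpha> h t \<tau> * v \<tau>) = G_fun T \<alpha> \<gamma> g q t"


section \<open>Graded mesh and collocation\<close>

definition mesh :: "real \<Rightarrow> real \<Rightarrow> nat \<Rightarrow> nat \<Rightarrow> real" where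
  "mesh T \<delta> N n = (real n / real N) powr \<delta> * T"

definition mesh_cell :: "real \<Rightarrow> real \<Rightarrow> nat \<Rightarrow> nat \<Rightarrow> real set" where
  "mesh_cell T \<delta> N n = {mesh T \<delta> N (n - 1) <.. mesh T \<delta> N n}"

definition mesh_step :: "real \<Rightarrow> real \<Rightarrow> nat \<Rightarrow> nat \<Rightarrow> real" where
  "mesh_step T \<delta> N n = mesh T \<delta> N n - mesh T \<delta> N (n - 1)"

definition max_step :: "real \<Rightarrow> real \<Rightarrow> nat \<Rightarrow> real" where
  "max_step T \<delta> N = Max (mesh_step T \<delta> N ` {1..N})"

text \<open>Functions on \<open>(0,T]\<close> are represented as extensional functions, so that uniqueness of the
  collocation solution can be stated as equality of functions.\<close>

definition dpl_space :: "real \<Rightarrow> real \<Rightarrow> nat \<Rightarrow> (real \<Rightarrow> real) set" where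
  "dpl_space T \<delta> N =
     {v \<in> extensional {0<..T}.
        \<forall>n\<in>{1..N}. \<exists>p :: real poly. degree p \<le> 1 \<and> (\<forall>t\<in>mesh_cell T \<delta> N n. v t = poly p t)}"

definition is_collocation_solution ::
    "real \<Rightarrow> real \<Rightarrow> real \<Rightarrow> (real \<Rightarrow> real \<Rightarrow> real) \<Rightarrow> (real \<Rightarrow> real) \<Rightarrow> (real \<Rightarrow> real)
      \<Rightarrow> real \<Rightarrow> real \<Rightarrow> real \<Rightarrow> nat \<Rightarrow> (real \<Rightarrow> real) \<Rightarrow> bool" where
  "is_collocation_solution T \<alpha> \<gamma> h g q \<xi>1 \<xi>2 \<delta> N v \<longleftrightarrow>
     v \<in> dpl_space T \<delta> N \<and>
     (\<forall>n\<in>{1..N}. \<forall>\<xi>\<in>{\<xi>1, \<xi>2}.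
        volterra_eq_at T \<alpha> \<gamma> h g q v (mesh T \<delta> N (n - 1) + \<xi> * mesh_step T \<delta> N n))"

definition Linfty_norm_on :: "real set \<Rightarrow> (real \<Rightarrow> real) \<Rightarrow> ereal" where
  "Linfty_norm_on A f = esssup (lebesgue_on A) (\<lambda>t. ereal \<bar>f t\<bar>)"

end

theory Submission
  imports Defs
begin

text \<open>The collocation solution is as good as interpolation, and interpolation on the graded mesh converges
at the claimed rate.

Write \<open>e = w - v\<close> and let \<open>\<Pi>\<close> be piecewise linear interpolation at the collocation points.
Since \<open>\<Pi> v = v\<close>, the error is \<open>e = (w - \<Pi> w) + \<Pi> e\<close>, and \<open>\<Pi> e\<close> involves only the values of
\<open>e\<close> at the collocation points, where subtracting the two equations gives \<open>H e = \<integral> E e\<close>. The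
kernel is at most \<open>M (t - \<tau>)\<^sup>\<alpha>\<^sup>-\<^sup>1\<close>, so the integral operator is small with respect to the weight
\<open>exp (\<kappa> t)\<close> once \<open>\<kappa>\<close> is large (\<open>Volterra_integral_weighted_bound\<close>). Measuring the values on
the \<open>n\<close>-th cell against \<open>exp (\<kappa> t\<^sub>n)\<close>, the discrete operator has norm at most \<open>1/2\<close> as soon as the
steps do not exceed \<open>1/\<kappa>\<close>. This choice of norm replaces a discrete weakly singular Gronwall
inequality, and it yields everything at once: a contraction on the finitely many collocation values,
hence existence (\<open>collocation_solution_exists\<close>); a bound of the error by a constant times
\<open>sup |w - \<Pi> w|\<close> (\<open>collocation_quasi_optimal\<close>); and uniqueness, because the latter applies to a
second collocation solution in the place of \<open>w\<close>, whose interpolation error is zero.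

It remains to bound the interpolation error by a multiple of \<open>N\<^sup>-\<^sup>\<sigma>\<^sup>\<delta>\<close> (\<open>interpolation_error\<close>). On the
first cell \<open>|w'| \<le> C\<^sub>0 t\<^sup>\<sigma>\<^sup>-\<^sup>1\<close> makes the oscillation of \<open>w\<close> at most a multiple of
\<open>t\<^sub>1\<^sup>\<sigma> = T\<^sup>\<sigma> N\<^sup>-\<^sup>\<sigma>\<^sup>\<delta>\<close>. On the cell \<open>n \<ge> 2\<close> the error is of order
\<open>\<Delta>t\<^sub>n\<^sup>2 t\<^sub>n\<^sub>-\<^sub>1\<^sup>\<sigma>\<^sup>-\<^sup>2\<close>, a multiple of \<open>N\<^sup>-\<^sup>\<sigma>\<^sup>\<delta> n\<^sup>\<sigma>\<^sup>\<delta>\<^sup>-\<^sup>2\<close>, and here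
\<open>\<sigma> \<delta> \<le> 2\<close> enters. Finally \<open>T / N\<close> is at most the largest step.\<close>

section \<open>Contractions in a weighted maximum norm\<close>

text \<open>Banach's theorem in \<open>\<real>\<^sup>I\<close> with the norm \<open>max |x i| / \<omega> i\<close>. The
iterates converge at each index of \<open>I\<close>, and finiteness of \<open>I\<close> turns this into convergence in
the norm, along which \<open>F\<close> is continuous.\<close>

lemma weighted_contraction_has_fixed_point:
  fixes F :: "('i \<Rightarrow> real) \<Rightarrow> 'i \<Rightarrow> real" and \<omega> :: "'i \<Rightarrow> real"
  assumes fin: "finite I" and \<omega>: "\<And>i. i \<in> I \<Longrightarrow> 0 < \<omega> i" and r: "0 \<le> r" "r < 1"
    and F: "\<And>x y B i. \<lbrakk>\<And>j. j \<in> I \<Longrightarrow> \<bar>x j - y j\<bar> \<le> B * \<omega> j; 0 \<le> B; i \<in> I\<rbrakk>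
              \<Longrightarrow> \<bar>F x i - F y i\<bar> \<le> r * B * \<omega> i"
  obtains x where "\<And>i. i \<in> I \<Longrightarrow> F x i = x i"
proof -
  define x where "x = (\<lambda>k. (F ^^ k) (\<lambda>_. 0))"
  have x_Suc: "x (Suc k) = F (x k)" for k by (simp add: x_def)
  define B where "B = (\<Sum>i\<in>I. \<bar>x 1 i - x 0 i\<bar> / \<omega> i)"
  have B: "0 \<le> B" unfolding B_def using \<omega> by (intro sum_nonneg) (auto simp: less_imp_le)
  have step: "\<bar>x (Suc k) i - x k i\<bar> \<le> (r ^ k * B) * \<omega> i" if "i \<in> I" for k i
    using that
  proof (induction k arbitrary: i)
    case 0
    have "\<bar>x 1 i - x 0 i\<bar> / \<omega> i \<le> B"
      unfolding B_def using 0 fin \<omega>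
      by (intro member_le_sum[where f = "\<lambda>i. \<bar>x 1 i - x 0 i\<bar> / \<omega> i"]) (auto simp: less_imp_le)
    then show ?case using \<omega>[OF 0] by (simp add: pos_divide_le_eq)
  next
    case (Suc k)
    have "\<bar>F (x (Suc k)) i - F (x k) i\<bar> \<le> r * (r ^ k * B) * \<omega> i"
      using Suc r B by (intro F) auto
    then show ?case by (simp add: x_Suc mult.assoc)
  qed
  have "convergent (\<lambda>k. x k i)" if i: "i \<in> I" for i
  proof -
    have "summable (\<lambda>k. x (Suc k) i - x k i)"
    proof (rule summable_comparison_test')
      show "summable (\<lambda>k. r ^ k * B * \<omega> i)"
        using r by (intro summable_mult2 summable_geometric) auto
      show "norm (x (Suc k) i - x k i) \<le> r ^ k * B * \<omega> i" if "k \<ge> 0" for k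
        using step[OF i] by simp
    qed
    then have "convergent (\<lambda>k. x k i - x 0 i)"
      using sum_lessThan_telescope[of "\<lambda>k. x k i"] by (simp add: summable_iff_convergent)
    then show ?thesis by (simp add: convergent_diff_const_right_iff)
  qed
  then have lim: "(\<lambda>k. x k i) \<longlonglongrightarrow> lim (\<lambda>k. x k i)" if "i \<in> I" for i
    using that convergent_LIMSEQ_iff by blast
  define L where "L = (\<lambda>i. lim (\<lambda>k. x k i))"
  show ?thesis
  proof (rule that)
    fix i assume i: "i \<in> I"
    have "(\<lambda>k. F (x k) i) \<longlonglongrightarrow> F L i"
    proof (rule LIMSEQ_I)
      fix \<epsilon> :: real assume \<epsilon>: "0 < \<epsilon>"
      define \<eta> where "\<eta> = \<epsilon> / (2 * \<omega> i)"
      have \<eta>: "0 < \<eta>" using \<epsilon> \<omega>[OF i] by (simp add: \<eta>_def)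
      have "\<forall>\<^sub>F k in sequentially. \<forall>j\<in>I. \<bar>x k j - L j\<bar> < \<eta> * \<omega> j"
      proof (intro eventually_ball_finite fin ballI)
        fix j assume j: "j \<in> I"
        then show "\<forall>\<^sub>F k in sequentially. \<bar>x k j - L j\<bar> < \<eta> * \<omega> j"
          using tendstoD[OF lim[OF j], of "\<eta> * \<omega> j"] \<eta> \<omega>[OF j] by (simp add: L_def dist_real_def)
      qed
      then obtain K where K: "\<And>k j. K \<le> k \<Longrightarrow> j \<in> I \<Longrightarrow> \<bar>x k j - L j\<bar> < \<eta> * \<omega> j"
        by (auto simp: eventually_sequentially)
      have "\<bar>F (x k) i - F L i\<bar> < \<epsilon>" if "K \<le> k" for k
      proof -
        have "\<bar>F (x k) i - F L i\<bar> \<le> r * \<eta> * \<omega> i"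
          using K[OF that] \<eta> i by (intro F) (auto simp: less_imp_le)
        also have "\<dots> \<le> 1 * (\<eta> * \<omega> i)"
          using r \<eta> \<omega>[OF i] unfolding mult.assoc by (intro mult_right_mono) auto
        also have "\<dots> < \<epsilon>" using \<omega>[OF i] \<epsilon> by (simp add: \<eta>_def)
        finally show ?thesis .
      qed
      then show "\<exists>K. \<forall>k\<ge>K. norm (F (x k) i - F L i) < \<epsilon>" by auto
    qed
    moreover have "(\<lambda>k. F (x k) i) \<longlonglongrightarrow> L i"
      using LIMSEQ_Suc[OF lim[OF i]] by (simp add: x_Suc L_def)
    ultimately show "F L i = L i" by (rule LIMSEQ_unique)
  qed
qed

text \<open>A bound in the weighted maximum norm that reproduces itself up to \<open>s\<close> can be absorbed, because the
maximum is a finite number that is attained.\<close>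

lemma weighted_self_bound:
  fixes e \<omega> :: "'i \<Rightarrow> real"
  assumes fin: "finite I" and \<omega>: "\<And>i. i \<in> I \<Longrightarrow> 0 < \<omega> i" and r: "r < 1"
    and step: "\<And>B i. \<lbrakk>\<And>j. j \<in> I \<Longrightarrow> \<bar>e j\<bar> \<le> B * \<omega> j; 0 \<le> B; i \<in> I\<rbrakk>
                 \<Longrightarrow> \<bar>e i\<bar> \<le> (r * B + s) * \<omega> i"
    and i: "i \<in> I"
  shows "\<bar>e i\<bar> \<le> s / (1 - r) * \<omega> i"
proof -
  define B where "B = Max ((\<lambda>i. \<bar>e i\<bar> / \<omega> i) ` I)"
  have B_ge: "\<bar>e j\<bar> / \<omega> j \<le> B" if "j \<in> I" for j
    using that fin by (auto simp: B_def)
  have "B \<in> (\<lambda>i. \<bar>e i\<bar> / \<omega> i) ` I"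
    unfolding B_def using fin i by (intro Max_in) auto
  then obtain k where k: "k \<in> I" "B = \<bar>e k\<bar> / \<omega> k" by auto
  have le: "\<bar>e j\<bar> \<le> B * \<omega> j" if "j \<in> I" for j
    using B_ge[OF that] \<omega>[OF that] by (simp add: divide_simps)
  have "0 \<le> B" using k \<omega>[OF k(1)] by simp
  then have "\<bar>e k\<bar> \<le> (r * B + s) * \<omega> k" using step le k(1) by blast
  moreover have "\<bar>e k\<bar> = B * \<omega> k" using k \<omega>[OF k(1)] by simp
  ultimately have "B \<le> r * B + s" using \<omega>[OF k(1)] by simp
  then have "B * (1 - r) \<le> s" by (simp add: algebra_simps)
  then have "B \<le> s / (1 - r)" using r by (simp add: pos_le_divide_eq)
  then show ?thesis using le[OF i] \<omega>[OF i]
    by (meson less_imp_le mult_right_mono order_trans)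
qed

section \<open>The weakly singular integral in an exponential weight\<close>

lemma has_integral_powr_reflected:
  fixes p t :: real
  assumes "0 < p" "0 \<le> t"
  shows "((\<lambda>\<tau>. (t - \<tau>) powr (p - 1)) has_integral t powr p / p) {0..t}"
proof -
  have "((\<lambda>\<tau>. (t - \<tau>) powr (p - 1)) has_integral
      (- ((t - t) powr p / p) - (- ((t - 0) powr p / p)))) {0..t}"
  proof (rule fundamental_theorem_of_calculus_interior)
    show "continuous_on {0..t} (\<lambda>\<tau>. - ((t - \<tau>) powr p / p))"
      using assms by (intro continuous_intros continuous_on_powr') auto
    show "((\<lambda>\<tau>. - ((t - \<tau>) powr p / p)) has_vector_derivative (t - x) powr (p - 1)) (at x)"
      if "x \<in> {0<..<t}" for x
      unfolding has_real_derivative_iff_has_vector_derivative[symmetric]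
      using that assms by (auto intro!: derivative_eq_intros)
  qed (use assms in auto)
  then show ?thesis by simp
qed

lemma powr_le_exp:
  fixes x p :: real
  assumes "0 < x" "0 < p" "p \<le> 1"
  shows "x powr p \<le> exp x"
proof -
  have "p * ln x \<le> x"
  proof (cases "0 \<le> ln x")
    case True
    then have "p * ln x \<le> 1 * ln x" using assms by (intro mult_right_mono) auto
    then show ?thesis using ln_le_minus_one[OF assms(1)] by simp
  next
    case False
    then have "p * ln x \<le> 0" using assms by (simp add: mult_nonneg_nonpos)
    then show ?thesis using assms by simp
  qed
  then show ?thesis using assms by (simp add: powr_def mult.commute)
qed

text \<open>Half of the singularity is traded for decay in \<open>\<kappa>\<close>: with \<open>s = t - \<tau>\<close>, this is
  \<open>(\<kappa> s)\<^sup>\<alpha>\<^sup>/\<^sup>2 \<le> e\<^sup>\<kappa>\<^sup>s\<close>, and the exponent \<open>\<alpha>/2 - 1\<close> that remains is still integrable.\<close>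

lemma weakly_singular_exp_bound:
  fixes \<alpha> \<kappa> t \<tau> :: real
  assumes "0 < \<alpha>" "\<alpha> \<le> 1" "0 < \<kappa>" "\<tau> < t"
  shows "(t - \<tau>) powr (\<alpha> - 1) * exp (\<kappa> * \<tau>)
      \<le> exp (\<kappa> * t) * \<kappa> powr (- (\<alpha> / 2)) * (t - \<tau>) powr (\<alpha> / 2 - 1)"
proof -
  define s where "s = t - \<tau>"
  have s: "0 < s" using assms by (simp add: s_def)
  have "\<kappa> powr (\<alpha> / 2) * s powr (\<alpha> / 2) \<le> exp (\<kappa> * s)"
    using powr_le_exp[of "\<kappa> * s" "\<alpha> / 2"] s assms by (simp add: powr_mult)
  then have "s powr (\<alpha> / 2) \<le> \<kappa> powr (- (\<alpha> / 2)) * exp (\<kappa> * s)"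
    using assms by (simp add: powr_minus field_simps)
  then have le: "(exp (\<kappa> * \<tau>) * s powr (\<alpha> / 2 - 1)) * s powr (\<alpha> / 2)
      \<le> (exp (\<kappa> * \<tau>) * s powr (\<alpha> / 2 - 1)) * (\<kappa> powr (- (\<alpha> / 2)) * exp (\<kappa> * s))"
    by (intro mult_left_mono) auto
  have "s powr (\<alpha> - 1) = s powr (\<alpha> / 2 - 1) * s powr (\<alpha> / 2)"
    by (simp flip: powr_add)
  moreover have "exp (\<kappa> * t) = exp (\<kappa> * \<tau>) * exp (\<kappa> * s)"
    by (simp add: s_def mult_exp_exp right_diff_distrib)
  ultimately show ?thesis using le unfolding s_def[symmetric] by (simp only: mult_ac)
qed

section \<open>Functions with a singular derivative at the origin\<close>

text \<open>The functions \<open>c / \<sigma> * t\<^sup>\<sigma> \<plusminus> w t\<close> are nondecreasing, their derivatives being nonnegative.\<close>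

lemma singular_derivative_imp_Hoelder:
  fixes w w' :: "real \<Rightarrow> real"
  assumes \<sigma>: "0 < \<sigma>"
    and w: "\<And>t. t \<in> {0<..T} \<Longrightarrow> (w has_real_derivative w' t) (at t within {0<..T})"
    and w': "\<And>t. t \<in> {0<..T} \<Longrightarrow> \<bar>w' t\<bar> \<le> c * t powr (\<sigma> - 1)"
    and st: "0 < s" "s \<le> t" "t \<le> T"
  shows "\<bar>w t - w s\<bar> \<le> c / \<sigma> * (t powr \<sigma> - s powr \<sigma>)"
proof -
  have cont: "continuous_on {s..t} w"
    using DERIV_continuous_on[OF w] by (rule continuous_on_subset) (use st in auto)
  have deriv: "(w has_real_derivative w' x) (at x)" if "s < x" "x < t" for x
  proof -
    have "(w has_real_derivative w' x) (at x within {0<..<T})"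
      by (rule has_field_derivative_subset[OF w]) (use that st in auto)
    then show ?thesis using that st by (simp add: at_within_open[of x "{0<..<T}"])
  qed
  have deriv_powr: "((\<lambda>x. c / \<sigma> * x powr \<sigma>) has_real_derivative c * x powr (\<sigma> - 1)) (at x)"
    if "s < x" for x
    using that st \<sigma> by (auto intro!: derivative_eq_intros)
  have cont_powr: "continuous_on {s..t} (\<lambda>x. c / \<sigma> * x powr \<sigma>)"
    using st by (intro continuous_intros) auto
  have "c / \<sigma> * s powr \<sigma> - w s \<le> c / \<sigma> * t powr \<sigma> - w t"
  proof (rule DERIV_nonneg_imp_increasing_open[OF st(2)])
    fix x assume x: "s < x" "x < t"
    show "\<exists>y. ((\<lambda>x. c / \<sigma> * x powr \<sigma> - w x) has_real_derivative y) (at x) \<and> 0 \<le> y"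
      using DERIV_diff[OF deriv_powr[OF x(1)] deriv[OF x]] w'[of x] x st by auto
  qed (intro continuous_on_diff cont cont_powr)
  moreover have "c / \<sigma> * s powr \<sigma> + w s \<le> c / \<sigma> * t powr \<sigma> + w t"
  proof (rule DERIV_nonneg_imp_increasing_open[OF st(2)])
    fix x assume x: "s < x" "x < t"
    show "\<exists>y. ((\<lambda>x. c / \<sigma> * x powr \<sigma> + w x) has_real_derivative y) (at x) \<and> 0 \<le> y"
      using DERIV_add[OF deriv_powr[OF x(1)] deriv[OF x]] w'[of x] x st by force
  qed (intro continuous_on_add cont cont_powr)
  ultimately show ?thesis by (simp add: right_diff_distrib abs_le_iff)
qed

text \<open>The constant is not the optimal \<open>D / 2\<close>; two applications of the mean value inequality, to \<open>w'\<close> and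
to \<open>w\<close> minus its tangent at \<open>t\<close>, suffice, and they need no case distinction on the order of
\<open>x\<close> and \<open>t\<close>.\<close>

lemma first_order_Taylor_bound:
  fixes w w' w'' :: "real \<Rightarrow> real"
  assumes S: "convex S"
    and w: "\<And>t. t \<in> S \<Longrightarrow> (w has_real_derivative w' t) (at t within S)"
    and w': "\<And>t. t \<in> S \<Longrightarrow> (w' has_real_derivative w'' t) (at t within S)"
    and w'': "\<And>t. t \<in> S \<Longrightarrow> \<bar>w'' t\<bar> \<le> D"
    and d: "\<And>s t. s \<in> S \<Longrightarrow> t \<in> S \<Longrightarrow> \<bar>s - t\<bar> \<le> d"
    and xt: "x \<in> S" "t \<in> S"
  shows "\<bar>w x - (w t + w' t * (x - t))\<bar> \<le> D * d\<^sup>2"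
proof -
  have D: "0 \<le> D" using w''[OF xt(1)] by linarith
  have d0: "0 \<le> d" using d[OF xt] by linarith
  have w'_diff: "\<bar>w' s - w' t\<bar> \<le> D * d" if "s \<in> S" for s
  proof -
    have "\<bar>w' s - w' t\<bar> \<le> D * \<bar>s - t\<bar>"
      using field_differentiable_bound[OF S w' _ that xt(2), of D] w'' by simp
    also have "\<dots> \<le> D * d" using d[OF that xt(2)] D by (intro mult_left_mono) auto
    finally show ?thesis .
  qed
  have "((\<lambda>s. w s - w' t * s) has_real_derivative (w' s - w' t)) (at s within S)" if "s \<in> S" for s
    using w[OF that] by (auto intro!: derivative_eq_intros)
  then have "\<bar>(w x - w' t * x) - (w t - w' t * t)\<bar> \<le> (D * d) * \<bar>x - t\<bar>"
    using field_differentiable_bound[OF S, of "\<lambda>s. w s - w' t * s" "\<lambda>s. w' s - w' t" "D * d" x t]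
      w'_diff xt by simp
  also have "\<dots> \<le> (D * d) * d" using d[OF xt] D d0 by (intro mult_left_mono) auto
  finally show ?thesis by (simp add: algebra_simps power2_eq_square)
qed

section \<open>Graded meshes\<close>

locale graded_mesh =
  fixes T \<delta> :: real
  assumes T_pos: "0 < T" and \<delta>_ge_1: "1 \<le> \<delta>"
begin

lemma mesh_0 [simp]: "mesh T \<delta> N 0 = 0"
  by (simp add: mesh_def)

lemma mesh_last: "1 \<le> N \<Longrightarrow> mesh T \<delta> N N = T"
  by (simp add: mesh_def)

lemma mesh_strict_mono: "1 \<le> N \<Longrightarrow> n < m \<Longrightarrow> mesh T \<delta> N n < mesh T \<delta> N m"
  using T_pos \<delta>_ge_1 by (auto simp: mesh_def divide_strict_right_mono intro!: powr_less_mono2)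

lemma mesh_mono: "1 \<le> N \<Longrightarrow> n \<le> m \<Longrightarrow> mesh T \<delta> N n \<le> mesh T \<delta> N m"
  using mesh_strict_mono[of N n m] by (cases "n = m") auto

lemma mesh_nonneg: "1 \<le> N \<Longrightarrow> 0 \<le> mesh T \<delta> N n"
  using mesh_mono[of N 0 n] by simp

lemma mesh_step_pos: "1 \<le> N \<Longrightarrow> n \<in> {1..N} \<Longrightarrow> 0 < mesh_step T \<delta> N n"
  using mesh_strict_mono[of N "n - 1" n] by (simp add: mesh_step_def)

lemma mesh_step_le_max: "n \<in> {1..N} \<Longrightarrow> mesh_step T \<delta> N n \<le> max_step T \<delta> N"
  unfolding max_step_def by (intro Max_ge) auto

lemma mesh_cell_subset: "1 \<le> N \<Longrightarrow> n \<in> {1..N} \<Longrightarrow> mesh_cell T \<delta> N n \<subseteq> {0<..T}"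
  using mesh_nonneg[of N "n - 1"] mesh_mono[of N n N] by (auto simp: mesh_cell_def mesh_last)

lemma mesh_cells_cover:
  assumes "1 \<le> N" "t \<in> {0<..T}"
  obtains n where "n \<in> {1..N}" "t \<in> mesh_cell T \<delta> N n"
proof -
  define n where "n = (LEAST n. t \<le> mesh T \<delta> N n)"
  have N: "t \<le> mesh T \<delta> N N" using assms by (simp add: mesh_last)
  have le: "t \<le> mesh T \<delta> N n" unfolding n_def using N by (rule LeastI)
  have "n \<le> N" unfolding n_def using N by (rule Least_le)
  moreover have "n \<noteq> 0" using le assms by (cases "n = 0") auto
  moreover have "\<not> t \<le> mesh T \<delta> N (n - 1)"
    using not_less_Least[of "n - 1" "\<lambda>n. t \<le> mesh T \<delta> N n"] \<open>n \<noteq> 0\<close> unfolding n_def by auto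
  ultimately show ?thesis using le by (intro that[of n]) (auto simp: mesh_cell_def)
qed

lemma mesh_cells_disjoint:
  assumes "1 \<le> N" "t \<in> mesh_cell T \<delta> N n" "t \<in> mesh_cell T \<delta> N m" "1 \<le> n" "1 \<le> m"
  shows "n = m"
proof -
  have False if "k < l" "t \<in> mesh_cell T \<delta> N k" "t \<in> mesh_cell T \<delta> N l" for k l
  proof -
    have "mesh T \<delta> N k \<le> mesh T \<delta> N (l - 1)" using that assms(1) by (intro mesh_mono) auto
    then show False using that by (simp add: mesh_cell_def)
  qed
  then show ?thesis using assms by (metis nat_neq_iff)
qed

text \<open>The last cell is already at least as long as a cell of the uniform mesh, because \<open>\<delta> \<ge> 1\<close>.\<close>

lemma max_step_ge_uniform:
  assumes "1 \<le> N"
  shows "T / real N \<le> max_step T \<delta> N"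
proof -
  have x: "0 \<le> (real N - 1) / real N" "(real N - 1) / real N \<le> 1" using assms by auto
  have "((real N - 1) / real N) powr \<delta> \<le> (real N - 1) / real N"
    using powr_mono'[of 1 \<delta> "(real N - 1) / real N"] x \<delta>_ge_1 by (cases "N = 1") auto
  then have "((real N - 1) / real N) powr \<delta> * T \<le> (real N - 1) / real N * T"
    using T_pos by (intro mult_right_mono) auto
  then have "mesh T \<delta> N (N - 1) \<le> (real N - 1) / real N * T"
    using assms by (simp add: mesh_def of_nat_diff)
  then have "T / real N \<le> mesh_step T \<delta> N N"
    using assms by (simp add: mesh_step_def mesh_last field_simps)
  also have "\<dots> \<le> max_step T \<delta> N" using assms by (intro mesh_step_le_max) auto
  finally show ?thesis .
qed

text \<open>The mean value theorem for \<open>x\<^sup>\<delta>\<close> between \<open>n - 1\<close> and \<open>n\<close>.\<close>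

lemma mesh_step_upper:
  assumes "1 \<le> N" "1 \<le> n"
  shows "mesh_step T \<delta> N n \<le> \<delta> * T * real n powr (\<delta> - 1) * (1 / real N) powr \<delta>"
proof -
  have "real n powr \<delta> - (real n - 1) powr \<delta> \<le> \<delta> * real n powr (\<delta> - 1)"
  proof (cases "n = 1")
    case True
    then show ?thesis using \<delta>_ge_1 by simp
  next
    case False
    then have n: "2 \<le> n" using assms by simp
    have "\<exists>z. real n - 1 < z \<and> z < real n \<and>
        real n powr \<delta> - (real n - 1) powr \<delta> = (real n - (real n - 1)) * (\<delta> * z powr (\<delta> - 1))"
      by (rule MVT2) (use n in \<open>auto intro!: derivative_eq_intros\<close>)
    then obtain z where z: "real n - 1 < z" "z < real n"
        "real n powr \<delta> - (real n - 1) powr \<delta> = \<delta> * z powr (\<delta> - 1)" by auto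
    have "z powr (\<delta> - 1) \<le> real n powr (\<delta> - 1)"
      using z n \<delta>_ge_1 by (intro powr_mono2) auto
    then show ?thesis using z \<delta>_ge_1 by (auto intro: mult_left_mono)
  qed
  then have "(real n powr \<delta> - (real n - 1) powr \<delta>) * ((1 / real N) powr \<delta> * T)
      \<le> \<delta> * real n powr (\<delta> - 1) * ((1 / real N) powr \<delta> * T)"
    using T_pos by (intro mult_right_mono) auto
  moreover have "mesh_step T \<delta> N n
      = (real n powr \<delta> - (real n - 1) powr \<delta>) * ((1 / real N) powr \<delta> * T)"
    using assms by (simp add: mesh_step_def mesh_def powr_divide of_nat_diff field_simps)
  ultimately show ?thesis by (simp add: mult_ac)
qed

text \<open>Where the grading pays off. Up to constants the step is at most \<open>n\<^sup>\<delta>\<^sup>-\<^sup>1 N\<^sup>-\<^sup>\<delta>\<close>, and the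
left end of the cell is at least \<open>(n / (2 N))\<^sup>\<delta> T\<close> because \<open>n - 1 \<ge> n / 2\<close>. The product therefore
decays like \<open>N\<^sup>-\<^sup>\<sigma>\<^sup>\<delta> n\<^sup>\<sigma>\<^sup>\<delta>\<^sup>-\<^sup>2\<close>, and the last factor is at most \<open>1\<close>.\<close>

lemma graded_step_bound:
  assumes N: "1 \<le> N" and n: "2 \<le> n" and \<sigma>: "\<sigma> < 2" "\<sigma> * \<delta> \<le> 2"
  shows "mesh T \<delta> N (n - 1) powr (\<sigma> - 2) * (mesh_step T \<delta> N n)\<^sup>2
      \<le> \<delta>\<^sup>2 * 2 powr (\<delta> * (2 - \<sigma>)) * T powr \<sigma> * (1 / real N) powr (\<sigma> * \<delta>)"
proof -
  define \<nu> where "\<nu> = 1 / real N"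
  have \<nu>: "0 < \<nu>" using N by (simp add: \<nu>_def)
  have n_pos: "0 < real n" using n by simp
  have "real n / 2 * \<nu> \<le> real (n - 1) * \<nu>"
    using n \<nu> by (intro mult_right_mono) auto
  then have "(real n * \<nu> / 2) powr \<delta> \<le> (real (n - 1) / real N) powr \<delta>"
    using n_pos \<nu> \<delta>_ge_1 by (intro powr_mono2) (auto simp: \<nu>_def)
  then have "(real n * \<nu> / 2) powr \<delta> * T \<le> mesh T \<delta> N (n - 1)"
    unfolding mesh_def using T_pos by (intro mult_right_mono) auto
  then have "mesh T \<delta> N (n - 1) powr (\<sigma> - 2) \<le> ((real n * \<nu> / 2) powr \<delta> * T) powr (\<sigma> - 2)"
    using \<sigma> n_pos \<nu> T_pos by (intro powr_mono2') auto
  moreover have "(mesh_step T \<delta> N n)\<^sup>2 \<le> (\<delta> * T * real n powr (\<delta> - 1) * \<nu> powr \<delta>)\<^sup>2"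
  proof (rule power_mono)
    show "mesh_step T \<delta> N n \<le> \<delta> * T * real n powr (\<delta> - 1) * \<nu> powr \<delta>"
      unfolding \<nu>_def using N n by (intro mesh_step_upper) auto
    show "0 \<le> mesh_step T \<delta> N n"
      using mesh_mono[OF N, of "n - 1" n] by (simp add: mesh_step_def)
  qed
  ultimately have "mesh T \<delta> N (n - 1) powr (\<sigma> - 2) * (mesh_step T \<delta> N n)\<^sup>2
      \<le> ((real n * \<nu> / 2) powr \<delta> * T) powr (\<sigma> - 2)
        * (\<delta> * T * real n powr (\<delta> - 1) * \<nu> powr \<delta>)\<^sup>2"
    by (intro mult_mono) auto
  also have "\<dots> = \<delta>\<^sup>2 * 2 powr (\<delta> * (2 - \<sigma>)) * T powr \<sigma> * \<nu> powr (\<sigma> * \<delta>) * real n powr (\<sigma> * \<delta> - 2)"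
  proof -
    have base: "((real n * \<nu> / 2) powr \<delta> * T) powr (\<sigma> - 2)
        = real n powr (\<delta> * (\<sigma> - 2)) * \<nu> powr (\<delta> * (\<sigma> - 2)) * 2 powr (\<delta> * (2 - \<sigma>)) * T powr (\<sigma> - 2)"
    proof -
      have "((real n * \<nu> / 2) powr \<delta> * T) powr (\<sigma> - 2)
          = (real n * \<nu> / 2) powr (\<delta> * (\<sigma> - 2)) * T powr (\<sigma> - 2)"
        using T_pos by (simp add: powr_mult powr_powr)
      also have "(real n * \<nu> / 2) powr (\<delta> * (\<sigma> - 2))
          = real n powr (\<delta> * (\<sigma> - 2)) * \<nu> powr (\<delta> * (\<sigma> - 2)) / 2 powr (\<delta> * (\<sigma> - 2))"
        using n_pos \<nu> by (simp only: powr_divide powr_mult)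
      also have "\<dots> = real n powr (\<delta> * (\<sigma> - 2)) * \<nu> powr (\<delta> * (\<sigma> - 2)) * 2 powr (\<delta> * (2 - \<sigma>))"
        using powr_minus_divide[of 2 "\<delta> * (\<sigma> - 2)"] by (simp add: right_diff_distrib)
      finally show ?thesis .
    qed
    have step: "(\<delta> * T * real n powr (\<delta> - 1) * \<nu> powr \<delta>)\<^sup>2
        = \<delta>\<^sup>2 * T powr 2 * real n powr (2 * (\<delta> - 1)) * \<nu> powr (2 * \<delta>)"
      using T_pos n_pos \<nu> by (simp add: power_mult_distrib powr_power mult.commute)
    have n_exp: "real n powr (\<delta> * (\<sigma> - 2)) * real n powr (2 * (\<delta> - 1)) = real n powr (\<sigma> * \<delta> - 2)"
      unfolding powr_add[symmetric] by (rule arg_cong[where f = "\<lambda>x. _ powr x"]) algebra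
    have nu_exp: "\<nu> powr (\<delta> * (\<sigma> - 2)) * \<nu> powr (2 * \<delta>) = \<nu> powr (\<sigma> * \<delta>)"
      unfolding powr_add[symmetric] by (rule arg_cong[where f = "\<lambda>x. _ powr x"]) algebra
    have T_exp: "T powr (\<sigma> - 2) * T powr 2 = T powr \<sigma>"
      unfolding powr_add[symmetric] by simp
    show ?thesis
      unfolding base step n_exp[symmetric] nu_exp[symmetric] T_exp[symmetric] by (simp only: mult_ac)
  qed
  also have "\<dots> \<le> \<delta>\<^sup>2 * 2 powr (\<delta> * (2 - \<sigma>)) * T powr \<sigma> * \<nu> powr (\<sigma> * \<delta>) * 1"
    using n \<sigma> powr_mono[of "\<sigma> * \<delta> - 2" 0 "real n"] by (intro mult_left_mono) auto
  finally show ?thesis by (simp add: \<nu>_def)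
qed

end

section \<open>Piecewise linear collocation\<close>

text \<open>The analysis sees the data through the order \<open>\<alpha> - 1\<close> of the singularity of the kernel on the
diagonal and through a positive lower bound for \<open>|H|\<close>.\<close>

locale collocation = graded_mesh +
  fixes \<xi>1 \<xi>2 \<alpha> M \<eta> :: real
    and K :: "real \<Rightarrow> real \<Rightarrow> real" and H G :: "real \<Rightarrow> real"
  assumes \<xi>: "0 < \<xi>1" "\<xi>1 < \<xi>2" "\<xi>2 < 1"
    and \<alpha>: "0 < \<alpha>" "\<alpha> \<le> 1" and M: "0 \<le> M" and \<eta>: "0 < \<eta>"
    and K_bound: "\<And>t \<tau>. \<lbrakk>0 < \<tau>; \<tau> < t; t \<le> T\<rbrakk> \<Longrightarrow> \<bar>K t \<tau>\<bar> \<le> M * (t - \<tau>) powr (\<alpha> - 1)"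
    and K_measurable: "\<And>t. \<lbrakk>0 < t; t \<le> T\<rbrakk> \<Longrightarrow> K t \<in> borel_measurable (lebesgue_on {0<..<t})"
    and H_bound: "\<And>t. \<lbrakk>0 < t; t \<le> T\<rbrakk> \<Longrightarrow> \<eta> \<le> \<bar>H t\<bar>"
begin

text \<open>The norm of the Volterra operator with respect to the weight \<open>exp (\<kappa> t)\<close> is at most this number,
which tends to \<open>0\<close> as \<open>\<kappa>\<close> grows.\<close>

definition smallness :: "real \<Rightarrow> real" where
  "smallness \<kappa> = M * \<kappa> powr (- (\<alpha> / 2)) * (T powr (\<alpha> / 2) / (\<alpha> / 2))"

lemma smallness_nonneg: "0 \<le> smallness \<kappa>"
  using M \<alpha> by (simp add: smallness_def)

lemma Volterra_integral_weighted_bound: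
  assumes t: "0 < t" "t \<le> T" and \<kappa>: "0 < \<kappa>" and A: "0 \<le> A"
    and meas: "f \<in> borel_measurable (lebesgue_on {0<..T})"
    and f: "\<And>\<tau>. \<tau> \<in> {0<..<t} \<Longrightarrow> \<bar>f \<tau>\<bar> \<le> A * exp (\<kappa> * \<tau>)"
  shows "(\<lambda>\<tau>. K t \<tau> * f \<tau>) integrable_on {0..t}"
    and "\<bar>integral {0..t} (\<lambda>\<tau>. K t \<tau> * f \<tau>)\<bar> \<le> smallness \<kappa> * A * exp (\<kappa> * t)"
proof -
  define c where "c = M * A * exp (\<kappa> * t) * \<kappa> powr (- (\<alpha> / 2))"
  have c: "0 \<le> c" using M A by (simp add: c_def)
  have dominated: "\<bar>K t \<tau> * f \<tau>\<bar> \<le> c * (t - \<tau>) powr (\<alpha> / 2 - 1)" if \<tau>: "\<tau> \<in> {0<..<t}" for \<tau>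
  proof -
    have "\<bar>K t \<tau> * f \<tau>\<bar> \<le> (M * (t - \<tau>) powr (\<alpha> - 1)) * (A * exp (\<kappa> * \<tau>))"
      unfolding abs_mult using K_bound[of \<tau> t] f[OF \<tau>] \<tau> t M by (intro mult_mono) auto
    also have "\<dots> = (M * A) * ((t - \<tau>) powr (\<alpha> - 1) * exp (\<kappa> * \<tau>))" by simp
    also have "\<dots> \<le> (M * A) * (exp (\<kappa> * t) * \<kappa> powr (- (\<alpha> / 2)) * (t - \<tau>) powr (\<alpha> / 2 - 1))"
      using weakly_singular_exp_bound[of \<alpha> \<kappa> \<tau> t] \<alpha> \<kappa> \<tau> M A by (intro mult_left_mono) auto
    finally show ?thesis by (simp add: c_def mult_ac)
  qed
  have major: "((\<lambda>\<tau>. c * (t - \<tau>) powr (\<alpha> / 2 - 1)) has_integral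
      c * (t powr (\<alpha> / 2) / (\<alpha> / 2))) {0<..<t}"
    using has_integral_mult_right[OF has_integral_powr_reflected[of "\<alpha> / 2" t], of c] \<alpha> t
    by (simp add: has_integral_Icc_iff_Ioo)
  have "f \<in> borel_measurable (lebesgue_on {0<..<t})"
    by (rule measurable_restrict_mono[OF meas]) (use t in auto)
  then have meas_prod: "(\<lambda>\<tau>. K t \<tau> * f \<tau>) \<in> borel_measurable (lebesgue_on {0<..<t})"
    using K_measurable[OF t] by (intro borel_measurable_times)
  have "(\<lambda>\<tau>. K t \<tau> * f \<tau>) integrable_on {0<..<t}"
    by (rule measurable_bounded_by_integrable_imp_integrable_real
        [OF meas_prod has_integral_integrable[OF major] dominated]) auto
  then show "(\<lambda>\<tau>. K t \<tau> * f \<tau>) integrable_on {0..t}"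
    by (simp add: integrable_on_Icc_iff_Ioo)
  have "\<bar>integral {0..t} (\<lambda>\<tau>. K t \<tau> * f \<tau>)\<bar> \<le> c * (t powr (\<alpha> / 2) / (\<alpha> / 2))"
    unfolding integral_open_interval_real
    using integral_norm_bound_integral'[OF _ meas_prod _ major] dominated
    by (simp only: real_norm_def) simp
  also have "\<dots> \<le> c * (T powr (\<alpha> / 2) / (\<alpha> / 2))"
    using c \<alpha> t by (intro mult_left_mono divide_right_mono powr_mono2) auto
  also have "\<dots> = smallness \<kappa> * A * exp (\<kappa> * t)"
    by (simp add: c_def smallness_def)
  finally show "\<bar>integral {0..t} (\<lambda>\<tau>. K t \<tau> * f \<tau>)\<bar> \<le> smallness \<kappa> * A * exp (\<kappa> * t)" .
qed

text \<open>The case \<open>\<kappa> = 1\<close> of the weighted bound, as every bounded function is dominated by a multiple of the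
weight.\<close>

lemma Volterra_integrable:
  assumes t: "0 < t" "t \<le> T"
    and meas: "f \<in> borel_measurable (lebesgue_on {0<..T})"
    and f: "\<And>\<tau>. \<tau> \<in> {0<..T} \<Longrightarrow> \<bar>f \<tau>\<bar> \<le> A"
  shows "(\<lambda>\<tau>. K t \<tau> * f \<tau>) integrable_on {0..t}"
proof (rule Volterra_integral_weighted_bound(1)[OF t zero_less_one _ meas])
  show "0 \<le> \<bar>A\<bar>" by simp
  fix \<tau> assume \<tau>: "\<tau> \<in> {0<..<t}"
  then have "\<bar>f \<tau>\<bar> \<le> \<bar>A\<bar> * 1" using f[of \<tau>] t by auto
  also have "\<dots> \<le> \<bar>A\<bar> * exp (1 * \<tau>)" using \<tau> by (intro mult_left_mono) auto
  finally show "\<bar>f \<tau>\<bar> \<le> \<bar>A\<bar> * exp (1 * \<tau>)" .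
qed

definition node :: "nat \<Rightarrow> nat \<Rightarrow> real \<Rightarrow> real" where
  "node N n \<xi> = mesh T \<delta> N (n - 1) + \<xi> * mesh_step T \<delta> N n"

definition node_index :: "nat \<Rightarrow> (nat \<times> real) set" where
  "node_index N = {1..N} \<times> {\<xi>1, \<xi>2}"

definition cell_interp :: "nat \<Rightarrow> nat \<Rightarrow> (nat \<times> real \<Rightarrow> real) \<Rightarrow> real \<Rightarrow> real" where
  "cell_interp N n c t =
     ((node N n \<xi>2 - t) * c (n, \<xi>1) + (t - node N n \<xi>1) * c (n, \<xi>2)) / (node N n \<xi>2 - node N n \<xi>1)"

text \<open>The sum over all cells with indicators, rather than a choice of the cell containing \<open>t\<close>, makes
measurability and linearity immediate.\<close>

definition interp :: "nat \<Rightarrow> (nat \<times> real \<Rightarrow> real) \<Rightarrow> real \<Rightarrow> real" where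
  "interp N c t = (\<Sum>n\<in>{1..N}. if t \<in> mesh_cell T \<delta> N n then cell_interp N n c t else 0)"

abbreviation sample :: "nat \<Rightarrow> (real \<Rightarrow> real) \<Rightarrow> nat \<times> real \<Rightarrow> real" where
  "sample N v \<equiv> \<lambda>(n, \<xi>). v (node N n \<xi>)"

text \<open>A bound for the Lebesgue constant of linear interpolation at \<open>\<xi>1\<close>, \<open>\<xi>2\<close> on \<open>[0,1]\<close>.\<close>

definition Lebesgue_const :: real where
  "Lebesgue_const = 2 / (\<xi>2 - \<xi>1)"

lemma Lebesgue_const_ge_1: "1 \<le> Lebesgue_const"
  using \<xi> by (simp add: Lebesgue_const_def divide_simps)

lemma finite_node_index [simp]: "finite (node_index N)"
  by (simp add: node_index_def)

lemma node_diff: "node N n \<xi>2 - node N n \<xi>1 = (\<xi>2 - \<xi>1) * mesh_step T \<delta> N n"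
  by (simp add: node_def algebra_simps)

lemma node_in_cell:
  assumes "1 \<le> N" "(n, x) \<in> node_index N"
  shows "node N n x \<in> mesh_cell T \<delta> N n"
proof -
  have n: "n \<in> {1..N}" and x: "0 < x" "x < 1" using assms \<xi> by (auto simp: node_index_def)
  note step = mesh_step_pos[OF assms(1) n]
  then have "x * mesh_step T \<delta> N n < mesh_step T \<delta> N n" "0 < x * mesh_step T \<delta> N n"
    using x by auto
  then show ?thesis unfolding node_def mesh_cell_def by (auto simp: mesh_step_def)
qed

lemma node_range:
  assumes "1 \<le> N" "(n, x) \<in> node_index N"
  shows "0 < node N n x" "node N n x \<le> T" "node N n x \<le> mesh T \<delta> N n"
proof -
  have "n \<in> {1..N}" using assms(2) by (auto simp: node_index_def)
  then show "0 < node N n x" "node N n x \<le> T" "node N n x \<le> mesh T \<delta> N n"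
    using node_in_cell[OF assms] mesh_cell_subset[OF assms(1), of n] by (auto simp: mesh_cell_def)
qed

lemma interp_on_cell:
  assumes "1 \<le> N" "n \<in> {1..N}" "t \<in> mesh_cell T \<delta> N n"
  shows "interp N c t = cell_interp N n c t"
proof -
  have "interp N c t = (\<Sum>m\<in>{1..N}. if m = n then cell_interp N n c t else 0)"
    unfolding interp_def
  proof (intro sum.cong refl)
    fix m assume "m \<in> {1..N}"
    then have "t \<in> mesh_cell T \<delta> N m \<longleftrightarrow> m = n"
      using assms mesh_cells_disjoint[OF assms(1), of t m n] by auto
    then show "(if t \<in> mesh_cell T \<delta> N m then cell_interp N m c t else 0)
        = (if m = n then cell_interp N n c t else 0)"
      by simp
  qed
  then show ?thesis using assms by simp
qed

text \<open>Every statement about the interpolation error reduces to this formula, since the Lagrange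
  weights sum to \<open>1\<close> and reproduce linear functions.\<close>

lemma cell_interp_diff:
  assumes "1 \<le> N" "n \<in> {1..N}"
  shows "cell_interp N n c t - (p + m * t) = cell_interp N n (\<lambda>(k, x). c (k, x) - (p + m * node N k x)) t"
proof -
  have d: "node N n \<xi>2 - node N n \<xi>1 \<noteq> 0"
    using mesh_step_pos[OF assms] \<xi> by (simp add: node_diff)
  have "(node N n \<xi>2 - t) * c (n, \<xi>1) + (t - node N n \<xi>1) * c (n, \<xi>2)
        - (p + m * t) * (node N n \<xi>2 - node N n \<xi>1)
      = (node N n \<xi>2 - t) * (c (n, \<xi>1) - (p + m * node N n \<xi>1))
        + (t - node N n \<xi>1) * (c (n, \<xi>2) - (p + m * node N n \<xi>2))"
    by algebra
  then show ?thesis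
    unfolding cell_interp_def prod.case divide_diff_eq_iff[OF d] by (rule arg_cong)
qed

lemma cell_interp_bound:
  assumes "1 \<le> N" "n \<in> {1..N}" "t \<in> mesh_cell T \<delta> N n"
    and c: "\<And>x. x \<in> {\<xi>1, \<xi>2} \<Longrightarrow> \<bar>c (n, x)\<bar> \<le> B"
  shows "\<bar>cell_interp N n c t\<bar> \<le> Lebesgue_const * B"
proof -
  define d where "d = mesh_step T \<delta> N n"
  have d: "0 < d" using mesh_step_pos[OF assms(1,2)] by (simp add: d_def)
  have B: "0 \<le> B" using c[of \<xi>1] by simp
  have in_cell: "node N n x \<in> mesh_cell T \<delta> N n" if "x \<in> {\<xi>1, \<xi>2}" for x
    using that assms(1,2) by (intro node_in_cell) (auto simp: node_index_def)
  then have dist: "\<bar>node N n x - t\<bar> \<le> d" if "x \<in> {\<xi>1, \<xi>2}" for x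
    using that assms(3) by (force simp: mesh_cell_def d_def mesh_step_def)
  have "\<bar>(node N n \<xi>2 - t) * c (n, \<xi>1) + (t - node N n \<xi>1) * c (n, \<xi>2)\<bar>
      \<le> \<bar>node N n \<xi>2 - t\<bar> * \<bar>c (n, \<xi>1)\<bar> + \<bar>node N n \<xi>1 - t\<bar> * \<bar>c (n, \<xi>2)\<bar>"
    using abs_triangle_ineq[of "(node N n \<xi>2 - t) * c (n, \<xi>1)" "(t - node N n \<xi>1) * c (n, \<xi>2)"]
    unfolding abs_mult abs_minus_commute[of t "node N n \<xi>1"] .
  also have "\<dots> \<le> d * B + d * B"
    using dist[of \<xi>1] dist[of \<xi>2] c[of \<xi>1] c[of \<xi>2] d by (intro add_mono mult_mono) simp_all
  finally have le: "\<bar>(node N n \<xi>2 - t) * c (n, \<xi>1) + (t - node N n \<xi>1) * c (n, \<xi>2)\<bar> \<le> d * B + d * B" .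
  have pos: "0 < (\<xi>2 - \<xi>1) * d" using d \<xi> by simp
  have "\<bar>cell_interp N n c t\<bar>
      = \<bar>(node N n \<xi>2 - t) * c (n, \<xi>1) + (t - node N n \<xi>1) * c (n, \<xi>2)\<bar> / ((\<xi>2 - \<xi>1) * d)"
    unfolding cell_interp_def node_diff d_def[symmetric] abs_divide abs_of_pos[OF pos] by (rule refl)
  also have "\<dots> \<le> (d * B + d * B) / ((\<xi>2 - \<xi>1) * d)"
    by (rule divide_right_mono[OF le less_imp_le[OF pos]])
  also have "\<dots> = (2 * B) * d / ((\<xi>2 - \<xi>1) * d)" by (simp add: mult.commute)
  also have "\<dots> = Lebesgue_const * B" using d by (simp add: Lebesgue_const_def)
  finally show ?thesis .
qed

lemma interp_diff: "interp N c t - interp N c' t = interp N (\<lambda>i. c i - c' i) t"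
proof -
  have "cell_interp N n c t - cell_interp N n c' t = cell_interp N n (\<lambda>i. c i - c' i) t" for n
    unfolding cell_interp_def diff_divide_distrib[symmetric]
    by (rule arg_cong[where f = "\<lambda>x. x / _"]) algebra
  then show ?thesis
    unfolding interp_def sum_subtractf[symmetric] by (intro sum.cong) simp_all
qed

lemma interp_at_node:
  assumes "1 \<le> N" "(n, x) \<in> node_index N"
  shows "interp N c (node N n x) = c (n, x)"
proof -
  have n: "n \<in> {1..N}" and x: "x \<in> {\<xi>1, \<xi>2}" using assms by (auto simp: node_index_def)
  have "node N n \<xi>2 - node N n \<xi>1 \<noteq> 0"
    using mesh_step_pos[OF assms(1) n] \<xi> by (simp add: node_diff)
  then show ?thesis
    using x interp_on_cell[OF assms(1) n node_in_cell[OF assms]] by (auto simp: cell_interp_def)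
qed

lemma interp_bounded:
  assumes "1 \<le> N" "t \<in> {0<..T}" and c: "\<And>i. i \<in> node_index N \<Longrightarrow> \<bar>c i\<bar> \<le> B"
  shows "\<bar>interp N c t\<bar> \<le> Lebesgue_const * B"
proof -
  obtain n where n: "n \<in> {1..N}" "t \<in> mesh_cell T \<delta> N n" using mesh_cells_cover[OF assms(1,2)] by metis
  show ?thesis
    unfolding interp_on_cell[OF assms(1) n]
    by (rule cell_interp_bound[OF assms(1) n c]) (use n in \<open>auto simp: node_index_def\<close>)
qed

lemma interp_bounded_ex:
  assumes "1 \<le> N"
  shows "\<exists>B. \<forall>t\<in>{0<..T}. \<bar>interp N c t\<bar> \<le> B"
proof -
  have "\<bar>c i\<bar> \<le> (\<Sum>i\<in>node_index N. \<bar>c i\<bar>)" if "i \<in> node_index N" for i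
    using that by (intro member_le_sum) auto
  then show ?thesis using interp_bounded[OF assms, of _ c] by metis
qed

lemma interp_measurable: "interp N c \<in> borel_measurable (lebesgue_on {0<..T})"
proof -
  have "(\<lambda>t. interp N c t) \<in> borel_measurable borel"
    unfolding interp_def cell_interp_def mesh_cell_def by measurable
  then have "interp N c \<in> borel_measurable lebesgue"
    by (simp add: borel_measurable_if_I lborelD measurable_completion)
  then show ?thesis by (rule measurable_restrict_space1)
qed

text \<open>A linear function interpolates itself, so the piecewise linear functions are exactly the
  interpolants and are parametrised by their values at the collocation points.\<close>

lemma dpl_space_eq_interp:
  assumes "1 \<le> N" "v \<in> dpl_space T \<delta> N" "t \<in> {0<..T}"
  shows "v t = interp N (sample N v) t"
proof -
  obtain n where n: "n \<in> {1..N}" "t \<in> mesh_cell T \<delta> N n" using mesh_cells_cover[OF assms(1,3)] by metis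
  obtain p where p: "degree p \<le> 1" "\<forall>t\<in>mesh_cell T \<delta> N n. v t = poly p t"
    using assms(2) n(1) unfolding dpl_space_def by blast
  have poly: "poly p s = coeff p 0 + coeff p 1 * s" for s
    using p(1) by (cases "degree p = 0") (auto simp: poly_altdef numeral_eq_Suc le_Suc_eq coeff_eq_0)
  have v_node: "v (node N n x) = poly p (node N n x)" if "x \<in> {\<xi>1, \<xi>2}" for x
    using that p node_in_cell[OF assms(1), of n x] n by (auto simp: node_index_def)
  have "interp N (sample N v) t - (coeff p 0 + coeff p 1 * t)
      = cell_interp N n (\<lambda>(k, x). v (node N k x) - poly p (node N k x)) t"
    unfolding interp_on_cell[OF assms(1) n] cell_interp_diff[OF assms(1) n(1)] poly
    by simp
  also have "\<dots> = 0" using v_node by (simp add: cell_interp_def)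
  finally show ?thesis using p(2) n(2) poly by simp
qed

lemma restrict_interp_in_dpl_space:
  assumes "1 \<le> N"
  shows "restrict (interp N c) {0<..T} \<in> dpl_space T \<delta> N"
  unfolding dpl_space_def
proof (intro CollectI conjI ballI)
  fix n assume n: "n \<in> {1..N}"
  define d where "d = node N n \<xi>2 - node N n \<xi>1"
  define p where "p = smult (1 / d) [:node N n \<xi>2 * c (n, \<xi>1) - node N n \<xi>1 * c (n, \<xi>2),
      c (n, \<xi>2) - c (n, \<xi>1):]"
  have "poly p t = cell_interp N n c t" for t
    by (simp add: p_def cell_interp_def d_def[symmetric] diff_divide_distrib add_divide_distrib
        algebra_simps)
  moreover have "degree p \<le> 1" by (simp add: p_def)
  ultimately show "\<exists>p. degree p \<le> 1 \<and>
      (\<forall>t\<in>mesh_cell T \<delta> N n. restrict (interp N c) {0<..T} t = poly p t)"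
    using n mesh_cell_subset[OF assms n] interp_on_cell[OF assms n] by (intro exI[of _ p]) auto
qed auto

section \<open>Existence, uniqueness and quasi-optimality of the collocation solution\<close>

definition collocates_at :: "(real \<Rightarrow> real) \<Rightarrow> real \<Rightarrow> bool" where
  "collocates_at v t \<longleftrightarrow> H t * v t - integral {0..t} (\<lambda>\<tau>. K t \<tau> * v \<tau>) = G t"

definition collocates :: "nat \<Rightarrow> (real \<Rightarrow> real) \<Rightarrow> bool" where
  "collocates N v \<longleftrightarrow> (\<forall>(n, x)\<in>node_index N. collocates_at v (node N n x))"

text \<open>In the weighted norm the interpolation operator costs \<open>Lebesgue_const * exp 1\<close> (see
\<open>interp_weighted_bound\<close>), the Volterra operator costs \<open>smallness \<kappa>\<close> and the division by \<open>H\<close>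
costs \<open>1 / \<eta>\<close>. The condition makes the composition a contraction with factor \<open>1 / 2\<close>.\<close>

definition admissible_weight :: "real \<Rightarrow> bool" where
  "admissible_weight \<kappa> \<longleftrightarrow> 0 < \<kappa> \<and> smallness \<kappa> / \<eta> * (Lebesgue_const * exp 1) \<le> 1 / 2"

lemma admissible_weight_exists: "\<exists>\<kappa>. admissible_weight \<kappa>"
proof -
  define P where "P = M * (T powr (\<alpha> / 2) / (\<alpha> / 2)) / \<eta> * (Lebesgue_const * exp 1)"
  define c where "c = 1 + 2 * P"
  have "0 \<le> P" using M \<alpha> \<eta> Lebesgue_const_ge_1 by (simp add: P_def)
  then have c: "1 \<le> c" by (simp add: c_def)
  \<comment> \<open>chosen so that the factor \<open>\<kappa> powr (- (\<alpha> / 2))\<close> in the smallness is \<open>1 / c\<close>\<close>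
  define \<kappa> where "\<kappa> = c powr (2 / \<alpha>)"
  have "smallness \<kappa> / \<eta> * (Lebesgue_const * exp 1) = P * \<kappa> powr (- (\<alpha> / 2))"
    by (simp add: smallness_def P_def mult_ac)
  also have "\<kappa> powr (- (\<alpha> / 2)) = 1 / c"
    using \<alpha> c by (simp add: \<kappa>_def powr_powr powr_minus_divide)
  also have "P * (1 / c) \<le> 1 / 2" using c by (simp add: c_def divide_simps)
  finally show ?thesis using c by (intro exI[of _ \<kappa>]) (simp add: admissible_weight_def \<kappa>_def)
qed

text \<open>Passing from the weight at a point to the weight at the right end of its cell costs the factor
  \<open>e\<close> only, since the steps do not exceed \<open>1/\<kappa>\<close>.\<close>

lemma interp_weighted_bound:
  assumes N: "1 \<le> N" and \<kappa>: "0 < \<kappa>" "max_step T \<delta> N \<le> 1 / \<kappa>" and B: "0 \<le> B"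
    and c: "\<And>n x. (n, x) \<in> node_index N \<Longrightarrow> \<bar>c (n, x)\<bar> \<le> B * exp (\<kappa> * mesh T \<delta> N n)"
    and t: "t \<in> {0<..T}"
  shows "\<bar>interp N c t\<bar> \<le> Lebesgue_const * exp 1 * B * exp (\<kappa> * t)"
proof -
  obtain n where n: "n \<in> {1..N}" "t \<in> mesh_cell T \<delta> N n" using mesh_cells_cover[OF N t] by metis
  have "\<bar>interp N c t\<bar> \<le> Lebesgue_const * (B * exp (\<kappa> * mesh T \<delta> N n))"
    unfolding interp_on_cell[OF N n]
    by (rule cell_interp_bound[OF N n]) (use n in \<open>auto intro!: c simp: node_index_def\<close>)
  also have "\<dots> \<le> Lebesgue_const * (B * exp (1 + \<kappa> * t))"
  proof -
    have "mesh T \<delta> N n \<le> t + max_step T \<delta> N"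
      using n(2) mesh_step_le_max[OF n(1)] by (simp add: mesh_cell_def mesh_step_def)
    also have "\<dots> \<le> t + 1 / \<kappa>" using \<kappa> by simp
    finally have "\<kappa> * mesh T \<delta> N n \<le> \<kappa> * (t + 1 / \<kappa>)" using \<kappa>(1) by (intro mult_left_mono) auto
    also have "\<dots> = 1 + \<kappa> * t" using \<kappa>(1) by (simp add: field_simps)
    finally show ?thesis using B Lebesgue_const_ge_1 by (intro mult_left_mono) auto
  qed
  also have "\<dots> = Lebesgue_const * exp 1 * B * exp (\<kappa> * t)" by (simp add: exp_add mult_ac)
  finally show ?thesis .
qed

lemma node_weight_mono:
  assumes "1 \<le> N" "(n, x) \<in> node_index N" "0 < \<kappa>"
  shows "exp (\<kappa> * node N n x) \<le> exp (\<kappa> * mesh T \<delta> N n)"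
  using node_range(3)[OF assms(1,2)] assms(3) by simp

text \<open>A piecewise linear function is determined by its values \<open>c\<close> at the collocation points, and the
scheme says that \<open>c\<close> is a fixed point of the map \<open>\<Phi>\<close> of the proof, a contraction in the
weighted norm.\<close>

lemma collocation_solution_exists:
  assumes N: "1 \<le> N" and \<kappa>: "admissible_weight \<kappa>" "max_step T \<delta> N \<le> 1 / \<kappa>"
  shows "\<exists>v \<in> dpl_space T \<delta> N. collocates N v"
proof -
  have \<kappa>_pos: "0 < \<kappa>" using \<kappa>(1) by (simp add: admissible_weight_def)
  define \<omega> :: "nat \<times> real \<Rightarrow> real" where "\<omega> = (\<lambda>(n, x). exp (\<kappa> * mesh T \<delta> N n))"
  define \<Phi> where "\<Phi> = (\<lambda>c (n, x).
    (G (node N n x) + integral {0..node N n x} (\<lambda>\<tau>. K (node N n x) \<tau> * interp N c \<tau>)) / H (node N n x))"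
  have \<omega>_pos: "0 < \<omega> i" for i by (simp add: \<omega>_def split: prod.split)
  have interp_integrable: "(\<lambda>\<tau>. K (node N n x) \<tau> * interp N c \<tau>) integrable_on {0..node N n x}"
    if "(n, x) \<in> node_index N" for n x c
  proof -
    obtain B where "\<forall>t\<in>{0<..T}. \<bar>interp N c t\<bar> \<le> B" using interp_bounded_ex[OF N] by blast
    then show ?thesis
      using node_range[OF N that] interp_measurable by (intro Volterra_integrable[where A = B]) auto
  qed
  have contraction: "\<bar>\<Phi> c i - \<Phi> c' i\<bar> \<le> 1 / 2 * B * \<omega> i"
    if cc': "\<And>j. j \<in> node_index N \<Longrightarrow> \<bar>c j - c' j\<bar> \<le> B * \<omega> j" and B: "0 \<le> B"
      and i: "i \<in> node_index N" for c c' B i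
  proof -
    obtain n x where nx: "i = (n, x)" by (cases i)
    define t where "t = node N n x"
    have t: "0 < t" "t \<le> T" using node_range[OF N, of n x] i nx by (auto simp: t_def)
    have H: "\<eta> \<le> \<bar>H t\<bar>" using t by (intro H_bound)
    have "integral {0..t} (\<lambda>\<tau>. K t \<tau> * interp N c \<tau>) - integral {0..t} (\<lambda>\<tau>. K t \<tau> * interp N c' \<tau>)
        = integral {0..t} (\<lambda>\<tau>. K t \<tau> * interp N (\<lambda>i. c i - c' i) \<tau>)"
      using interp_integrable[of n x] i nx
      by (simp add: t_def right_diff_distrib flip: integral_diff interp_diff)
    then have "\<bar>\<Phi> c i - \<Phi> c' i\<bar>
        = \<bar>integral {0..t} (\<lambda>\<tau>. K t \<tau> * interp N (\<lambda>i. c i - c' i) \<tau>)\<bar> / \<bar>H t\<bar>"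
      unfolding \<Phi>_def nx prod.case t_def[symmetric]
      by (simp flip: diff_divide_distrib abs_divide)
    also have "\<dots> \<le> \<bar>integral {0..t} (\<lambda>\<tau>. K t \<tau> * interp N (\<lambda>i. c i - c' i) \<tau>)\<bar> / \<eta>"
      using H \<eta> by (intro divide_left_mono) auto
    also have "\<dots> \<le> smallness \<kappa> * (Lebesgue_const * exp 1 * B) * exp (\<kappa> * t) / \<eta>"
    proof (intro divide_right_mono Volterra_integral_weighted_bound(2) t \<kappa>_pos interp_measurable)
      fix \<tau> assume \<tau>: "\<tau> \<in> {0<..<t}"
      show "\<bar>interp N (\<lambda>i. c i - c' i) \<tau>\<bar> \<le> Lebesgue_const * exp 1 * B * exp (\<kappa> * \<tau>)"
        using cc' \<tau> t by (intro interp_weighted_bound N \<kappa>_pos \<kappa> B) (auto simp: \<omega>_def)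
    qed (use B \<eta> Lebesgue_const_ge_1 in auto)
    also have "\<dots> = smallness \<kappa> / \<eta> * (Lebesgue_const * exp 1) * B * exp (\<kappa> * t)" by simp
    also have "\<dots> \<le> 1 / 2 * B * exp (\<kappa> * mesh T \<delta> N n)"
      using \<kappa>(1) B node_weight_mono[OF N _ \<kappa>_pos, of n x] i nx
      unfolding t_def admissible_weight_def by (intro mult_mono) auto
    finally show ?thesis by (simp add: \<omega>_def nx)
  qed
  have "\<exists>c. \<forall>i\<in>node_index N. \<Phi> c i = c i"
  proof (rule weighted_contraction_has_fixed_point[of "node_index N" \<omega> "1 / 2" \<Phi>])
    show "\<bar>\<Phi> c i - \<Phi> c' i\<bar> \<le> 1 / 2 * B * \<omega> i"
      if "\<And>j. j \<in> node_index N \<Longrightarrow> \<bar>c j - c' j\<bar> \<le> B * \<omega> j" "0 \<le> B" "i \<in> node_index N" for c c' B i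
      using that by (rule contraction)
    show "\<exists>c. \<forall>i\<in>node_index N. \<Phi> c i = c i"
      if "\<And>i. i \<in> node_index N \<Longrightarrow> \<Phi> c i = c i" for c
      using that by blast
  qed (simp_all add: \<omega>_pos)
  then obtain c where c: "\<And>i. i \<in> node_index N \<Longrightarrow> \<Phi> c i = c i" by blast
  have "collocates N (restrict (interp N c) {0<..T})"
    unfolding collocates_def
  proof safe
    fix n x assume nx: "(n, x) \<in> node_index N"
    define t where "t = node N n x"
    have t: "0 < t" "t \<le> T" using node_range[OF N nx] by (auto simp: t_def)
    \<comment> \<open>extensionality changes the integrand at \<open>\<tau> = 0\<close> only\<close>
    have "integral {0..t} (\<lambda>\<tau>. K t \<tau> * restrict (interp N c) {0<..T} \<tau>)
        = integral {0..t} (\<lambda>\<tau>. K t \<tau> * interp N c \<tau>)"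
      unfolding integral_open_interval_real using t by (intro integral_cong) auto
    moreover have "H t \<noteq> 0" using H_bound[OF t] \<eta> by auto
    moreover have "interp N c t = c (n, x)" unfolding t_def by (rule interp_at_node[OF N nx])
    moreover have "c (n, x) = (G t + integral {0..t} (\<lambda>\<tau>. K t \<tau> * interp N c \<tau>)) / H t"
      using c[OF nx] by (simp add: \<Phi>_def t_def)
    ultimately show "collocates_at (restrict (interp N c) {0<..T}) (node N n x)"
      using t unfolding collocates_at_def t_def[symmetric] by simp
  qed
  then show ?thesis using restrict_interp_in_dpl_space[OF N] by blast
qed

text \<open>The argument uses the equation for \<open>w\<close> at the collocation points; stated with this hypothesis, the
theorem also compares two collocation solutions. The error at a point is bounded by \<open>R\<close> plus the
interpolant of its values at the collocation points, and the Volterra equation bounds these values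
by half of themselves plus \<open>R / 2\<close> in the weighted norm.\<close>

theorem collocation_quasi_optimal:
  assumes N: "1 \<le> N" and \<kappa>: "admissible_weight \<kappa>" "max_step T \<delta> N \<le> 1 / \<kappa>"
    and w_meas: "w \<in> borel_measurable (lebesgue_on {0<..T})"
    and w_bound: "\<And>t. t \<in> {0<..T} \<Longrightarrow> \<bar>w t\<bar> \<le> W"
    and w: "collocates N w"
    and v: "v \<in> dpl_space T \<delta> N" "collocates N v"
    and R: "\<And>t. t \<in> {0<..T} \<Longrightarrow> \<bar>w t - interp N (sample N w) t\<bar> \<le> R"
    and t: "t \<in> {0<..T}"
  shows "\<bar>w t - v t\<bar> \<le> (1 + Lebesgue_const * exp 1) * exp (\<kappa> * T) * R"
proof -
  have \<kappa>_pos: "0 < \<kappa>" using \<kappa>(1) by (simp add: admissible_weight_def)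
  define \<Lambda> where "\<Lambda> = Lebesgue_const * exp 1"
  have \<Lambda>: "1 \<le> \<Lambda>"
    using mult_mono[of 1 Lebesgue_const 1 "exp 1"] Lebesgue_const_ge_1 by (simp add: \<Lambda>_def)
  have R_nonneg: "0 \<le> R" using R[OF t] by linarith
  define \<omega> :: "nat \<times> real \<Rightarrow> real" where "\<omega> = (\<lambda>(n, x). exp (\<kappa> * mesh T \<delta> N n))"
  define e where "e = (\<lambda>t. w t - v t)"
  have v_eq: "v s = interp N (sample N v) s" if "s \<in> {0<..T}" for s
    using dpl_space_eq_interp[OF N v(1) that] .
  have v_meas: "v \<in> borel_measurable (lebesgue_on {0<..T})"
    using interp_measurable[of N "sample N v"]
    by (subst measurable_cong[where g = "interp N (sample N v)"]) (auto simp: v_eq)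
  obtain V where V: "\<And>s. s \<in> {0<..T} \<Longrightarrow> \<bar>v s\<bar> \<le> V"
    using interp_bounded_ex[OF N, of "sample N v"] v_eq by metis
  have e_meas: "e \<in> borel_measurable (lebesgue_on {0<..T})"
    unfolding e_def using w_meas v_meas by (rule borel_measurable_diff)
  \<comment> \<open>the error is the interpolation error plus the interpolant of its own values at the nodes\<close>
  have e_bound: "\<bar>e s\<bar> \<le> (R + \<Lambda> * B) * exp (\<kappa> * s)"
    if B: "\<And>i. i \<in> node_index N \<Longrightarrow> \<bar>sample N e i\<bar> \<le> B * \<omega> i" "0 \<le> B" and s: "s \<in> {0<..T}"
    for B s
  proof -
    have "e s = (w s - interp N (sample N w) s) + interp N (sample N e) s"
    proof -
      have "(\<lambda>i. sample N w i - sample N v i) = sample N e" by (auto simp: e_def)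
      then show ?thesis
        using interp_diff[of N "sample N w" s "sample N v"] v_eq[OF s] by (simp add: e_def)
    qed
    then have "\<bar>e s\<bar> \<le> \<bar>w s - interp N (sample N w) s\<bar> + \<bar>interp N (sample N e) s\<bar>" by linarith
    also have "\<dots> \<le> R + \<Lambda> * B * exp (\<kappa> * s)"
      unfolding \<Lambda>_def using B by (intro add_mono R s interp_weighted_bound N \<kappa>_pos \<kappa>) (auto simp: \<omega>_def)
    also have "\<dots> \<le> R * exp (\<kappa> * s) + \<Lambda> * B * exp (\<kappa> * s)"
      using mult_left_mono[of 1 "exp (\<kappa> * s)" R] R_nonneg s \<kappa>_pos by simp
    finally show ?thesis by (simp add: distrib_right)
  qed
  \<comment> \<open>subtracting the two equations at a collocation point closes the loop with factor \<open>1 / 2\<close>\<close>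
  have self: "\<bar>sample N e i\<bar> \<le> (1 / 2 * B + R / 2) * \<omega> i"
    if B: "\<And>j. j \<in> node_index N \<Longrightarrow> \<bar>sample N e j\<bar> \<le> B * \<omega> j" "0 \<le> B" and i: "i \<in> node_index N"
    for B i
  proof -
    obtain n x where nx: "i = (n, x)" by (cases i)
    define t where "t = node N n x"
    have t: "0 < t" "t \<le> T" using node_range[OF N, of n x] i nx by (auto simp: t_def)
    have H: "\<eta> \<le> \<bar>H t\<bar>" using t by (intro H_bound)
    have "(\<lambda>\<tau>. K t \<tau> * w \<tau>) integrable_on {0..t}" "(\<lambda>\<tau>. K t \<tau> * v \<tau>) integrable_on {0..t}"
      using Volterra_integrable[OF t w_meas w_bound] Volterra_integrable[OF t v_meas V] by auto
    then have "integral {0..t} (\<lambda>\<tau>. K t \<tau> * e \<tau>)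
        = integral {0..t} (\<lambda>\<tau>. K t \<tau> * w \<tau>) - integral {0..t} (\<lambda>\<tau>. K t \<tau> * v \<tau>)"
      by (simp add: e_def right_diff_distrib integral_diff)
    moreover have "collocates_at w t" "collocates_at v t"
      using w v(2) i by (auto simp: collocates_def nx t_def)
    ultimately have "H t * e t = integral {0..t} (\<lambda>\<tau>. K t \<tau> * e \<tau>)"
      by (simp add: collocates_at_def e_def right_diff_distrib)
    then have "\<bar>H t\<bar> * \<bar>e t\<bar> = \<bar>integral {0..t} (\<lambda>\<tau>. K t \<tau> * e \<tau>)\<bar>"
      by (simp flip: abs_mult)
    also have "\<dots> \<le> smallness \<kappa> * (R + \<Lambda> * B) * exp (\<kappa> * t)"
      using e_bound[OF B] t R_nonneg \<Lambda> B(2)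
      by (intro Volterra_integral_weighted_bound(2) t \<kappa>_pos e_meas) auto
    finally have "\<bar>H t\<bar> * \<bar>e t\<bar> \<le> smallness \<kappa> * (R + \<Lambda> * B) * exp (\<kappa> * t)" .
    moreover have "\<eta> * \<bar>e t\<bar> \<le> \<bar>H t\<bar> * \<bar>e t\<bar>" using H by (intro mult_right_mono) auto
    ultimately have "\<bar>e t\<bar> \<le> smallness \<kappa> * (R + \<Lambda> * B) * exp (\<kappa> * t) / \<eta>"
      using \<eta> by (simp add: pos_le_divide_eq mult.commute)
    also have "\<dots> = smallness \<kappa> / \<eta> * (R + \<Lambda> * B) * exp (\<kappa> * t)" by simp
    also have "\<dots> \<le> (smallness \<kappa> / \<eta> * \<Lambda>) * (R + B) * exp (\<kappa> * t)"
    proof -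
      have "R + \<Lambda> * B \<le> \<Lambda> * (R + B)"
        using mult_right_mono[OF \<Lambda> R_nonneg] by (simp add: distrib_left)
      then have "smallness \<kappa> / \<eta> * (R + \<Lambda> * B) \<le> smallness \<kappa> / \<eta> * (\<Lambda> * (R + B))"
        using smallness_nonneg[of \<kappa>] \<eta> by (intro mult_left_mono) auto
      then show ?thesis by (intro mult_right_mono) (simp_all only: mult.assoc exp_ge_zero)
    qed
    also have "\<dots> \<le> 1 / 2 * (R + B) * exp (\<kappa> * mesh T \<delta> N n)"
      using \<kappa>(1) B(2) R_nonneg node_weight_mono[OF N _ \<kappa>_pos, of n x] i nx
      unfolding t_def admissible_weight_def \<Lambda>_def by (intro mult_mono) auto
    finally show ?thesis by (simp add: \<omega>_def nx t_def algebra_simps)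
  qed
  have "\<bar>sample N e i\<bar> \<le> R * \<omega> i" if "i \<in> node_index N" for i
  proof -
    have "\<bar>sample N e i\<bar> \<le> (R / 2) / (1 - 1 / 2) * \<omega> i"
      by (rule weighted_self_bound[OF finite_node_index _ _ self that]) (auto simp: \<omega>_def)
    then show ?thesis by simp
  qed
  then have "\<bar>e t\<bar> \<le> (R + \<Lambda> * R) * exp (\<kappa> * t)" using R_nonneg t by (rule e_bound)
  also have "\<dots> \<le> (R + \<Lambda> * R) * exp (\<kappa> * T)"
    using R_nonneg \<Lambda> t \<kappa>_pos by (intro mult_left_mono) auto
  finally show ?thesis by (simp add: e_def \<Lambda>_def algebra_simps)
qed

text \<open>Quasi-optimality with \<open>R = 0\<close>: one solution plays the role of \<open>w\<close>, and it is its own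
interpolant.\<close>

lemma collocation_solution_unique:
  assumes N: "1 \<le> N" and \<kappa>: "admissible_weight \<kappa>" "max_step T \<delta> N \<le> 1 / \<kappa>"
    and u: "u \<in> dpl_space T \<delta> N" "collocates N u"
    and v: "v \<in> dpl_space T \<delta> N" "collocates N v"
  shows "u = v"
proof
  fix t
  have u_eq: "u s = interp N (sample N u) s" if "s \<in> {0<..T}" for s
    using dpl_space_eq_interp[OF N u(1) that] .
  have u_meas: "u \<in> borel_measurable (lebesgue_on {0<..T})"
    using interp_measurable[of N "sample N u"]
    by (subst measurable_cong[where g = "interp N (sample N u)"]) (auto simp: u_eq)
  obtain U where U: "\<And>s. s \<in> {0<..T} \<Longrightarrow> \<bar>u s\<bar> \<le> U"
    using interp_bounded_ex[OF N, of "sample N u"] u_eq by metis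
  show "u t = v t"
  proof (cases "t \<in> {0<..T}")
    case True
    have "\<bar>u s - interp N (sample N u) s\<bar> \<le> 0" if "s \<in> {0<..T}" for s using u_eq[OF that] by simp
    then have "\<bar>u t - v t\<bar> \<le> (1 + Lebesgue_const * exp 1) * exp (\<kappa> * T) * 0"
      using collocation_quasi_optimal[OF N \<kappa> u_meas U u(2) v _ True] by blast
    then show ?thesis by simp
  next
    case False
    then show ?thesis using u(1) v(1) by (simp add: dpl_space_def extensional_def)
  qed
qed

section \<open>Interpolation error and convergence rate\<close>

text \<open>The comparison function is a line through \<open>(t, w t)\<close>. Interpolation reproduces it, so that only the
deviation of \<open>w\<close> from the line is interpolated. The slope is left open: \<open>0\<close> is used in the
first cell, the tangent in the others.\<close>

lemma interpolation_error_via_linear: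
  assumes "1 \<le> N" "n \<in> {1..N}" "t \<in> mesh_cell T \<delta> N n"
    and B: "\<And>s. s \<in> mesh_cell T \<delta> N n \<Longrightarrow> \<bar>w s - (w t + m * (s - t))\<bar> \<le> B"
  shows "\<bar>w t - interp N (sample N w) t\<bar> \<le> Lebesgue_const * B"
proof -
  have "interp N (sample N w) t - w t
      = cell_interp N n (sample N w) t - ((w t - m * t) + m * t)"
    by (simp add: interp_on_cell[OF assms(1-3)])
  also have "\<dots> = cell_interp N n
      (\<lambda>(k, x). sample N w (k, x) - ((w t - m * t) + m * node N k x)) t"
    by (rule cell_interp_diff[OF assms(1,2)])
  also have "\<bar>\<dots>\<bar> \<le> Lebesgue_const * B"
  proof (rule cell_interp_bound[OF assms(1-3)])
    fix x assume "x \<in> {\<xi>1, \<xi>2}"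
    then have "node N n x \<in> mesh_cell T \<delta> N n"
      using assms(1,2) by (intro node_in_cell) (auto simp: node_index_def)
    from B[OF this] show "\<bar>case (n, x) of (k, x) \<Rightarrow>
        sample N w (k, x) - ((w t - m * t) + m * node N k x)\<bar> \<le> B"
      by (simp add: algebra_simps)
  qed
  finally show ?thesis by (simp add: abs_minus_commute)
qed

text \<open>The rate is first obtained in terms of \<open>1 / N\<close>, which is at most a multiple of the largest step.\<close>

lemma interpolation_error:
  fixes w w' w'' :: "real \<Rightarrow> real"
  assumes \<sigma>: "0 < \<sigma>" "\<sigma> < 1" "\<sigma> * \<delta> \<le> 2"
    and w: "\<And>t. t \<in> {0<..T} \<Longrightarrow> (w has_real_derivative w' t) (at t within {0<..T})"
    and w': "\<And>t. t \<in> {0<..T} \<Longrightarrow> (w' has_real_derivative w'' t) (at t within {0<..T})"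
    and reg: "\<And>t. t \<in> {0<..T} \<Longrightarrow> \<bar>w' t\<bar> + t * \<bar>w'' t\<bar> \<le> C0 * t powr (\<sigma> - 1)"
  shows "\<exists>C\<ge>0. \<forall>N\<ge>1. \<forall>t\<in>{0<..T}.
      \<bar>w t - interp N (sample N w) t\<bar> \<le> C * max_step T \<delta> N powr (\<sigma> * \<delta>)"
proof -
  have "0 \<le> \<bar>w' T\<bar> + T * \<bar>w'' T\<bar>" using T_pos by simp
  also have "\<dots> \<le> C0 * T powr (\<sigma> - 1)" using reg T_pos by simp
  finally have C0: "0 \<le> C0" using T_pos by (simp add: zero_le_mult_iff)
  have w'_bound: "\<bar>w' t\<bar> \<le> C0 * t powr (\<sigma> - 1)" if "t \<in> {0<..T}" for t
  proof -
    have "0 \<le> t * \<bar>w'' t\<bar>" using that by simp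
    then show ?thesis using reg[OF that] by linarith
  qed
  have w''_bound: "\<bar>w'' t\<bar> \<le> C0 * t powr (\<sigma> - 2)" if t: "t \<in> {0<..T}" for t
  proof -
    have "t * \<bar>w'' t\<bar> \<le> C0 * t powr (\<sigma> - 1)" using reg[OF t] by simp
    also have "t powr (\<sigma> - 1) = t * t powr (\<sigma> - 2)"
      using t powr_add[of t 1 "\<sigma> - 2"] by simp
    finally have "t * \<bar>w'' t\<bar> \<le> t * (C0 * t powr (\<sigma> - 2))" by (simp add: mult_ac)
    then show ?thesis using t by simp
  qed
  define A1 where "A1 = C0 / \<sigma> * T powr \<sigma>"
  define A2 where "A2 = C0 * (\<delta>\<^sup>2 * 2 powr (\<delta> * (2 - \<sigma>)) * T powr \<sigma>)"
  define A where "A = Lebesgue_const * (A1 + A2)"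
  have A12: "0 \<le> A1" "0 \<le> A2" using C0 \<sigma> by (simp_all add: A1_def A2_def)
  then have A: "0 \<le> A" using Lebesgue_const_ge_1 by (simp add: A_def)
  have uniform: "\<bar>w t - interp N (sample N w) t\<bar> \<le> A * (1 / real N) powr (\<sigma> * \<delta>)"
    if N: "1 \<le> N" and t: "t \<in> {0<..T}" for N t
  proof -
    obtain n where n: "n \<in> {1..N}" "t \<in> mesh_cell T \<delta> N n"
      using mesh_cells_cover[OF N t] by metis
    define rate where "rate = (1 / real N) powr (\<sigma> * \<delta>)"
    have rate: "0 \<le> rate" by (simp add: rate_def)
    have cell: "mesh_cell T \<delta> N n \<subseteq> {0<..T}" by (rule mesh_cell_subset[OF N n(1)])
    have "\<exists>m. \<forall>s\<in>mesh_cell T \<delta> N n. \<bar>w s - (w t + m * (s - t))\<bar> \<le> (A1 + A2) * rate"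
    proof (cases "n = 1")
      case True
      \<comment> \<open>the bound for \<open>w''\<close> blows up at \<open>0\<close>, so the comparison line is the constant \<open>w t\<close>\<close>
      have mesh_1: "C0 / \<sigma> * mesh T \<delta> N 1 powr \<sigma> = A1 * rate"
        using T_pos N by (simp add: A1_def rate_def mesh_def powr_mult powr_powr mult_ac)
      have oscillation: "\<bar>w y - w x\<bar> \<le> A1 * rate"
        if "x \<in> mesh_cell T \<delta> N n" "y \<in> mesh_cell T \<delta> N n" "x \<le> y" for x y
      proof -
        have xy: "0 < x" "y \<le> mesh T \<delta> N 1" "y \<le> T"
          using that subsetD[OF cell that(1)] subsetD[OF cell that(2)] True by (auto simp: mesh_cell_def)
        have "\<bar>w y - w x\<bar> \<le> C0 / \<sigma> * (y powr \<sigma> - x powr \<sigma>)"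
          using xy that \<sigma> by (intro singular_derivative_imp_Hoelder[OF \<sigma>(1) w w'_bound]) auto
        also have "\<dots> \<le> C0 / \<sigma> * mesh T \<delta> N 1 powr \<sigma>"
        proof (rule mult_left_mono)
          have "y powr \<sigma> \<le> mesh T \<delta> N 1 powr \<sigma>"
            using xy that \<sigma> by (intro powr_mono2) auto
          then show "y powr \<sigma> - x powr \<sigma> \<le> mesh T \<delta> N 1 powr \<sigma>"
            using powr_ge_zero[of x \<sigma>] by linarith
        qed (use C0 \<sigma> in simp)
        finally show ?thesis unfolding mesh_1 .
      qed
      have "\<bar>w s - (w t + 0 * (s - t))\<bar> \<le> (A1 + A2) * rate" if s: "s \<in> mesh_cell T \<delta> N n" for s
      proof -
        have "\<bar>w s - w t\<bar> \<le> A1 * rate"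
          using oscillation[OF s n(2)] oscillation[OF n(2) s]
          by (cases "s \<le> t") (auto simp: abs_minus_commute)
        also have "\<dots> \<le> (A1 + A2) * rate" using A12 rate by (intro mult_right_mono) auto
        finally show ?thesis by simp
      qed
      then show ?thesis by blast
    next
      case False
      then have n2: "2 \<le> n" using n by auto
      have t_pos: "0 < mesh T \<delta> N (n - 1)" using mesh_strict_mono[OF N, of 0 "n - 1"] n2 by simp
      define D where "D = C0 * mesh T \<delta> N (n - 1) powr (\<sigma> - 2)"
      have "\<bar>w s - (w t + w' t * (s - t))\<bar> \<le> (A1 + A2) * rate" if s: "s \<in> mesh_cell T \<delta> N n" for s
      proof -
        have "\<bar>w s - (w t + w' t * (s - t))\<bar> \<le> D * (mesh_step T \<delta> N n)\<^sup>2"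
        proof (rule first_order_Taylor_bound[where S = "mesh_cell T \<delta> N n" and w'' = w''])
          show "convex (mesh_cell T \<delta> N n)" by (simp add: mesh_cell_def)
          fix x assume x: "x \<in> mesh_cell T \<delta> N n"
          then have xT: "x \<in> {0<..T}" using cell by blast
          show "(w has_real_derivative w' x) (at x within mesh_cell T \<delta> N n)"
            by (rule has_field_derivative_subset[OF w[OF xT] cell])
          show "(w' has_real_derivative w'' x) (at x within mesh_cell T \<delta> N n)"
            by (rule has_field_derivative_subset[OF w'[OF xT] cell])
          have "x powr (\<sigma> - 2) \<le> mesh T \<delta> N (n - 1) powr (\<sigma> - 2)"
            using x t_pos \<sigma> by (intro powr_mono2') (auto simp: mesh_cell_def)
          then have "C0 * x powr (\<sigma> - 2) \<le> D" unfolding D_def using C0 by (rule mult_left_mono)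
          then show "\<bar>w'' x\<bar> \<le> D" using w''_bound[OF xT] by linarith
        next
          fix x y assume "x \<in> mesh_cell T \<delta> N n" "y \<in> mesh_cell T \<delta> N n"
          then show "\<bar>x - y\<bar> \<le> mesh_step T \<delta> N n" by (auto simp: mesh_cell_def mesh_step_def)
        qed (use s n in auto)
        also have "\<dots> = C0 * (mesh T \<delta> N (n - 1) powr (\<sigma> - 2) * (mesh_step T \<delta> N n)\<^sup>2)"
          by (simp add: D_def)
        also have "\<dots> \<le> C0 * (\<delta>\<^sup>2 * 2 powr (\<delta> * (2 - \<sigma>)) * T powr \<sigma> * rate)"
          unfolding rate_def using \<sigma> C0 by (intro mult_left_mono graded_step_bound[OF N n2]) auto
        also have "\<dots> = A2 * rate" by (simp add: A2_def)
        also have "\<dots> \<le> (A1 + A2) * rate" using A12 rate by (intro mult_right_mono) auto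
        finally show ?thesis .
      qed
      then show ?thesis by blast
    qed
    then obtain m where "\<And>s. s \<in> mesh_cell T \<delta> N n \<Longrightarrow>
        \<bar>w s - (w t + m * (s - t))\<bar> \<le> (A1 + A2) * rate"
      by blast
    then have "\<bar>w t - interp N (sample N w) t\<bar> \<le> Lebesgue_const * ((A1 + A2) * rate)"
      by (rule interpolation_error_via_linear[OF N n])
    then show ?thesis by (simp add: A_def rate_def)
  qed
  define C where "C = A * (1 / T) powr (\<sigma> * \<delta>)"
  have "\<bar>w t - interp N (sample N w) t\<bar> \<le> C * max_step T \<delta> N powr (\<sigma> * \<delta>)"
    if N: "1 \<le> N" and t: "t \<in> {0<..T}" for N t
  proof -
    have le: "1 / real N \<le> 1 / T * max_step T \<delta> N"
      using max_step_ge_uniform[OF N] T_pos by (simp add: field_simps)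
    have max_pos: "0 \<le> max_step T \<delta> N"
      using max_step_ge_uniform[OF N] T_pos N by (smt (verit) divide_nonneg_nonneg of_nat_0_le_iff)
    have "(1 / real N) powr (\<sigma> * \<delta>) \<le> (1 / T * max_step T \<delta> N) powr (\<sigma> * \<delta>)"
      using le \<sigma> \<delta>_ge_1 by (intro powr_mono2) auto
    also have "\<dots> = (1 / T) powr (\<sigma> * \<delta>) * max_step T \<delta> N powr (\<sigma> * \<delta>)"
      using T_pos max_pos by (intro powr_mult) 
    finally have "A * (1 / real N) powr (\<sigma> * \<delta>) \<le> C * max_step T \<delta> N powr (\<sigma> * \<delta>)"
      unfolding C_def mult.assoc using A by (rule mult_left_mono)
    then show ?thesis using uniform[OF N t] by linarith
  qed
  moreover have "0 \<le> C" using A by (simp add: C_def)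
  ultimately show ?thesis by blast
qed

text \<open>The solution is bounded and continuous on \<open>(0, T]\<close> because its derivative is integrable at \<open>0\<close>;
with this, quasi-optimality and the interpolation error combine.\<close>

theorem collocation_convergence:
  fixes w w' w'' :: "real \<Rightarrow> real"
  assumes \<sigma>: "0 < \<sigma>" "\<sigma> < 1" "\<sigma> * \<delta> \<le> 2"
    and w: "\<And>t. t \<in> {0<..T} \<Longrightarrow> (w has_real_derivative w' t) (at t within {0<..T})"
    and w': "\<And>t. t \<in> {0<..T} \<Longrightarrow> (w' has_real_derivative w'' t) (at t within {0<..T})"
    and reg: "\<And>t. t \<in> {0<..T} \<Longrightarrow> \<bar>w' t\<bar> + t * \<bar>w'' t\<bar> \<le> C0 * t powr (\<sigma> - 1)"
    and solution: "\<And>t. t \<in> {0<..T} \<Longrightarrow> collocates_at w t"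
  shows "\<exists>C>0. \<exists>k0>0. \<forall>N\<ge>1. max_step T \<delta> N < k0 \<longrightarrow>
      (\<exists>!v. v \<in> dpl_space T \<delta> N \<and> collocates N v) \<and>
      (\<forall>v. v \<in> dpl_space T \<delta> N \<and> collocates N v \<longrightarrow>
        (\<forall>t\<in>{0<..T}. \<bar>w t - v t\<bar> \<le> C * max_step T \<delta> N powr (\<sigma> * \<delta>)))"
proof -
  obtain \<kappa> where \<kappa>: "admissible_weight \<kappa>" using admissible_weight_exists by blast
  have \<kappa>_pos: "0 < \<kappa>" using \<kappa> by (simp add: admissible_weight_def)
  obtain A where A: "0 \<le> A" "\<And>N t. 1 \<le> N \<Longrightarrow> t \<in> {0<..T} \<Longrightarrow>
      \<bar>w t - interp N (sample N w) t\<bar> \<le> A * max_step T \<delta> N powr (\<sigma> * \<delta>)"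
    using interpolation_error[OF \<sigma> w w' reg] by blast
  define C where "C = (1 + Lebesgue_const * exp 1) * exp (\<kappa> * T) * A + 1"
  have "0 < C" using A Lebesgue_const_ge_1 by (simp add: C_def add_nonneg_pos)
  have w_meas: "w \<in> borel_measurable (lebesgue_on {0<..T})"
    by (rule continuous_imp_measurable_on_sets_lebesgue[OF DERIV_continuous_on[OF w]]) auto
  have w'_bound: "\<bar>w' t\<bar> \<le> C0 * t powr (\<sigma> - 1)" if "t \<in> {0<..T}" for t
  proof -
    have "0 \<le> t * \<bar>w'' t\<bar>" using that by simp
    then show ?thesis using reg[OF that] by linarith
  qed
  have C0: "0 \<le> C0"
    using w'_bound[of T] T_pos by (smt (verit) greaterThanAtMost_iff mult_neg_pos powr_gt_zero)
  have w_bound: "\<bar>w t\<bar> \<le> \<bar>w T\<bar> + C0 / \<sigma> * T powr \<sigma>" if t: "t \<in> {0<..T}" for t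
  proof -
    have "\<bar>w T - w t\<bar> \<le> C0 / \<sigma> * (T powr \<sigma> - t powr \<sigma>)"
      using t by (intro singular_derivative_imp_Hoelder[OF \<sigma>(1) w w'_bound]) auto
    also have "\<dots> \<le> C0 / \<sigma> * T powr \<sigma>" using C0 \<sigma> by (intro mult_left_mono) auto
    finally show ?thesis by linarith
  qed
  have "(\<exists>!v. v \<in> dpl_space T \<delta> N \<and> collocates N v) \<and>
      (\<forall>v. v \<in> dpl_space T \<delta> N \<and> collocates N v \<longrightarrow>
        (\<forall>t\<in>{0<..T}. \<bar>w t - v t\<bar> \<le> C * max_step T \<delta> N powr (\<sigma> * \<delta>)))"
    if N: "1 \<le> N" and "max_step T \<delta> N < 1 / \<kappa>" for N
  proof (intro conjI allI impI ballI)
    have step: "max_step T \<delta> N \<le> 1 / \<kappa>" using that by simp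
    show "\<exists>!v. v \<in> dpl_space T \<delta> N \<and> collocates N v"
      using collocation_solution_exists[OF N \<kappa> step] collocation_solution_unique[OF N \<kappa> step]
      by blast
    fix v t assume v: "v \<in> dpl_space T \<delta> N \<and> collocates N v" and t: "t \<in> {0<..T}"
    have "collocates N w"
      unfolding collocates_def using solution node_range(1,2)[OF N] by auto
    then have "\<bar>w t - v t\<bar> \<le> (1 + Lebesgue_const * exp 1) * exp (\<kappa> * T)
        * (A * max_step T \<delta> N powr (\<sigma> * \<delta>))"
      using v A(2)[OF N] by (intro collocation_quasi_optimal[OF N \<kappa> step w_meas w_bound _ _ _ _ t]) auto
    also have "\<dots> \<le> C * max_step T \<delta> N powr (\<sigma> * \<delta>)" by (simp add: C_def distrib_right)
    finally show "\<bar>w t - v t\<bar> \<le> C * max_step T \<delta> N powr (\<sigma> * \<delta>)" .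
  qed
  then show ?thesis using \<open>0 < C\<close> \<kappa>_pos
    by (intro exI[of _ C] conjI exI[of _ "1 / \<kappa>"] allI impI) auto
qed

end

section \<open>The collocation scheme for the inverse source problem\<close>

theorem mainTheorem1:
  fixes T \<alpha> \<gamma> \<sigma> \<delta> \<xi>1 \<xi>2 a b C0 :: real
    and h :: "real \<Rightarrow> real \<Rightarrow> real" and g q :: "real \<Rightarrow> real"
    and w w' w'' :: "real \<Rightarrow> real"
  assumes "T > 0"
    and "0 < \<alpha>" and "\<alpha> \<le> \<gamma>" and "\<gamma> \<le> 1" and "\<alpha> + \<gamma> > 1"
    and "0 < \<sigma>" and "\<sigma> < 1"
    and "0 < \<xi>1" and "\<xi>1 < \<xi>2" and "\<xi>2 < 1"
    and "1 \<le> \<delta>" and "\<delta> \<le> 2 / \<sigma>"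
    and "regular_data T \<alpha> \<gamma> h g q"
    and "continuous_on {(t, \<tau>). 0 \<le> \<tau> \<and> \<tau> \<le> t \<and> t \<le> T} (\<lambda>(t, \<tau>). E_tilde \<alpha> h t \<tau>)"
    and "bounded ((\<lambda>(t, \<tau>). E_tilde \<alpha> h t \<tau>) ` {(t, \<tau>). 0 \<le> \<tau> \<and> \<tau> \<le> t \<and> t \<le> T})"
    and "continuous_on {0<..T} (G_fun T \<alpha> \<gamma> g q)"
    and "continuous_on {0..T} (H_fun h)"
    and "\<And>t. t \<in> {0..T} \<Longrightarrow> H_fun h t \<noteq> 0"
    and "\<And>t. t \<in> {0<..T} \<Longrightarrow> volterra_eq_at T \<alpha> \<gamma> h g q w t"
    and "\<And>t. t \<in> {0<..T} \<Longrightarrow> (w has_real_derivative w' t) (at t within {0<..T})"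
    and "\<And>t. t \<in> {0<..T} \<Longrightarrow> (w' has_real_derivative w'' t) (at t within {0<..T})"
    and "continuous_on {0<..T} w''"
    and "\<And>t. t \<in> {0<..T} \<Longrightarrow> \<bar>w t\<bar> \<le> a * (1 + t powr \<alpha>) + b * t powr (\<gamma> - 1)"
    and "\<And>t. t \<in> {0<..T} \<Longrightarrow> \<bar>w' t\<bar> + t * \<bar>w'' t\<bar> \<le> C0 * t powr (\<sigma> - 1)"
  shows "\<exists>C>0. \<exists>k0>0. \<forall>N\<ge>1. max_step T \<delta> N < k0 \<longrightarrow>
           (\<exists>!v. is_collocation_solution T \<alpha> \<gamma> h g q \<xi>1 \<xi>2 \<delta> N v) \<and>
           (\<forall>v. is_collocation_solution T \<alpha> \<gamma> h g q \<xi>1 \<xi>2 \<delta> N v \<longrightarrow>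
              (\<forall>n\<in>{1..N}. Linfty_norm_on (mesh_cell T \<delta> N n) (\<lambda>t. w t - v t)
                 \<le> ereal (C * max_step T \<delta> N powr (\<sigma> * \<delta>))))"
proof -
  note T = assms(1) and \<alpha> = assms(2-4) and \<sigma> = assms(6,7) and \<xi> = assms(8-10)
    and \<delta> = assms(11,12) and data = assms(13) and E_cont = assms(14) and E_bounded = assms(15)
    and H_cont = assms(17) and H_nz = assms(18) and solution = assms(19)
    and w = assms(20) and w' = assms(21) and reg = assms(24)
  have E_eq: "E_kernel \<alpha> h t \<tau> = (t - \<tau>) powr (\<alpha> - 1) * E_tilde \<alpha> h t \<tau>"
    if "0 \<le> \<tau>" "\<tau> \<le> t" "t \<le> T" for t \<tau>
    using data that by (intro E_kernel_eq_E_tilde) (simp add: regular_data_def)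
  obtain M where M': "\<forall>x\<in>(\<lambda>(t, \<tau>). E_tilde \<alpha> h t \<tau>) ` {(t, \<tau>). 0 \<le> \<tau> \<and> \<tau> \<le> t \<and> t \<le> T}. norm x \<le> M"
    using E_bounded unfolding bounded_iff by blast
  have M: "\<bar>E_tilde \<alpha> h t \<tau>\<bar> \<le> M" if "0 \<le> \<tau>" "\<tau> \<le> t" "t \<le> T" for t \<tau>
    using bspec[OF M' imageI[of "(t, \<tau>)"]] that by simp
  have "continuous_on {0..T} (\<lambda>t. \<bar>H_fun h t\<bar>)" using H_cont by (rule continuous_on_rabs)
  then have "\<exists>s\<in>{0..T}. \<forall>t\<in>{0..T}. \<bar>H_fun h s\<bar> \<le> \<bar>H_fun h t\<bar>"
    using T by (intro continuous_attains_inf) auto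
  then obtain s where s: "s \<in> {0..T}" "\<And>t. t \<in> {0..T} \<Longrightarrow> \<bar>H_fun h s\<bar> \<le> \<bar>H_fun h t\<bar>"
    by blast
  interpret collocation T \<delta> \<xi>1 \<xi>2 \<alpha> M "\<bar>H_fun h s\<bar>" "E_kernel \<alpha> h" "H_fun h" "G_fun T \<alpha> \<gamma> g q"
  proof
    show "0 \<le> M" using M[of 0 0] T by simp
    show "0 < \<bar>H_fun h s\<bar>" using H_nz[OF s(1)] by simp
    show "\<bar>H_fun h s\<bar> \<le> \<bar>H_fun h t\<bar>" if "0 < t" "t \<le> T" for t
      using s(2)[of t] that by simp
    show "\<bar>E_kernel \<alpha> h t \<tau>\<bar> \<le> M * (t - \<tau>) powr (\<alpha> - 1)" if "0 < \<tau>" "\<tau> < t" "t \<le> T" for t \<tau>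
      using mult_right_mono[OF M[of \<tau> t], of "(t - \<tau>) powr (\<alpha> - 1)"] that
      by (simp add: E_eq abs_mult mult.commute)
    show "E_kernel \<alpha> h t \<in> borel_measurable (lebesgue_on {0<..<t})" if t: "0 < t" "t \<le> T" for t
    proof (rule continuous_imp_measurable_on_sets_lebesgue)
      have "continuous_on {0<..<t} (\<lambda>\<tau>. case (t, \<tau>) of (t, \<tau>) \<Rightarrow> E_tilde \<alpha> h t \<tau>)"
        by (rule continuous_on_compose2[OF E_cont]) (use t in \<open>auto intro!: continuous_intros\<close>)
      then have "continuous_on {0<..<t} (\<lambda>\<tau>. (t - \<tau>) powr (\<alpha> - 1) * E_tilde \<alpha> h t \<tau>)"
        by (intro continuous_intros) auto
      then show "continuous_on {0<..<t} (E_kernel \<alpha> h t)"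
        using t by (subst continuous_on_cong[OF refl E_eq]) auto
    qed simp
  qed (use T \<alpha> \<xi> \<delta> in auto)
  have collocation_iff: "is_collocation_solution T \<alpha> \<gamma> h g q \<xi>1 \<xi>2 \<delta> N v
      \<longleftrightarrow> v \<in> dpl_space T \<delta> N \<and> collocates N v" for N v
    by (auto simp: is_collocation_solution_def volterra_eq_at_def collocates_def collocates_at_def
        node_index_def node_def)
  have "\<sigma> * \<delta> \<le> 2" using \<delta> \<sigma> by (simp add: pos_le_divide_eq mult.commute)
  moreover have "collocates_at w t" if "t \<in> {0<..T}" for t
    using solution[OF that] by (simp add: volterra_eq_at_def collocates_at_def)
  ultimately obtain C k0 where "0 < C" "0 < k0" and conv: "\<forall>N\<ge>1. max_step T \<delta> N < k0 \<longrightarrow>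
      (\<exists>!v. v \<in> dpl_space T \<delta> N \<and> collocates N v) \<and>
      (\<forall>v. v \<in> dpl_space T \<delta> N \<and> collocates N v \<longrightarrow>
        (\<forall>t\<in>{0<..T}. \<bar>w t - v t\<bar> \<le> C * max_step T \<delta> N powr (\<sigma> * \<delta>)))"
    using collocation_convergence[OF \<sigma> _ w w' reg] by auto
  have error: "\<bar>w t - v t\<bar> \<le> C * max_step T \<delta> N powr (\<sigma> * \<delta>)"
    if "1 \<le> N" "max_step T \<delta> N < k0" "v \<in> dpl_space T \<delta> N" "collocates N v" "t \<in> {0<..T}" for N v t
    using conv that by blast
  have "Linfty_norm_on (mesh_cell T \<delta> N n) (\<lambda>t. w t - v t)
      \<le> ereal (C * max_step T \<delta> N powr (\<sigma> * \<delta>))"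
    if N: "1 \<le> N" "max_step T \<delta> N < k0" and v: "v \<in> dpl_space T \<delta> N" "collocates N v"
      and n: "n \<in> {1..N}" for N v n
    unfolding Linfty_norm_on_def
  proof (rule esssup_I)
    note cell = mesh_cell_subset[OF N(1) n]
    obtain p where p: "\<forall>t\<in>mesh_cell T \<delta> N n. v t = poly p t"
      using v(1) n unfolding dpl_space_def by blast
    have "continuous_on (mesh_cell T \<delta> N n) (\<lambda>t. \<bar>w t - poly p t\<bar>)"
      by (intro continuous_intros continuous_on_subset[OF DERIV_continuous_on[OF w] cell])
    then have "continuous_on (mesh_cell T \<delta> N n) (\<lambda>t. \<bar>w t - v t\<bar>)"
      using p by (simp cong: continuous_on_cong)
    then have "(\<lambda>t. \<bar>w t - v t\<bar>) \<in> borel_measurable (lebesgue_on (mesh_cell T \<delta> N n))"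
      by (rule continuous_imp_measurable_on_sets_lebesgue) (simp add: mesh_cell_def)
    then show "(\<lambda>t. ereal \<bar>w t - v t\<bar>) \<in> borel_measurable (lebesgue_on (mesh_cell T \<delta> N n))"
      by (rule borel_measurable_ereal)
    show "AE t in lebesgue_on (mesh_cell T \<delta> N n).
        ereal \<bar>w t - v t\<bar> \<le> ereal (C * max_step T \<delta> N powr (\<sigma> * \<delta>))"
      by (rule AE_I2) (use error[OF N v] cell in auto)
  qed
  then show ?thesis
    unfolding collocation_iff using \<open>0 < C\<close> \<open>0 < k0\<close> conv
    by (intro exI[of _ C] exI[of _ k0] conjI allI impI ballI) auto
qed

end
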